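(* Let $n\ge1$ and let $\lambda=l_1\Lambda_1+\cdots+l_n\Lambda_n$ be a dominant integral weight of type $A_n$. Identify $\mathcal{B}(\lambda)$ with the crystal of semistandard tableaux of shape $\lambda$, and let $\mathcal{M}(\lambda)$ be the explicit set of Nakajima monomials defined in the context, with crystal structure restricted from the crystal $\mathcal{M}$ of Nakajima monomials. Let $\Psi:\mathcal{B}(\lambda)\to\mathcal{M}(\lambda)$ be the bijection sending the semistandard tableau $S$ of shape $\lambda$ whose $i$-th row has exactly $b_k^i$ boxes with entry $k$ ($1\le i\le n$, $i\le k\le n+1$) to $$\Psi(S)=\prod_{i=1}^n\ \prod_{k=i}^{n+1}X_k(-i)^{b_k^i}.$$ Then $\Psi$ is a $U_q(A_n)$-crystal isomorphism. Therefore there is a $U_q(A_n)$-crystal isomorphism $\mathcal{B}(\lambda)\overset{\sim}{\longrightarrow}\mathcal{M}(\lambda)$.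
   Context: General. Let $I=\{1,\dots,n\}$, Cartan matrix of type $A_n$, simple roots $\alpha_i$, fundamental weights $\Lambda_i$. A $U_q(A_n)$-crystal is an abstract (Kashiwara) crystal for this Cartan datum. A crystal isomorphism is a bijection preserving $\mathrm{wt},\varepsilon_i,\varphi_i$ and commuting with all $\tilde e_i,\tilde f_i$ ($0\mapsto0$). $\mathcal{B}(\lambda)$ is the irreducible highest weight crystal of highest weight $\lambda$. Nakajima monomials. $\mathcal{M}$ is the set of Laurent monomials $\prod_{(i,m)\in I\times\mathbf{Z}}Y_i(m)^{y_i(m)}$ with $y_i(m)\in\mathbf{Z}$ zero for all but finitely many $(i,m)$. Put $Y_0(k)=Y_{n+1}(k)=1$ and $$A_i(m)=Y_i(m)Y_i(m+1)Y_{i-1}(m+1)^{-1}Y_{i+1}(m)^{-1}.$$ For $M=\prod Y_i(m)^{y_i(m)}$ set $\mathrm{wt}(M)=\sum_i(\sum_m y_i(m))\Lambda_i$, $\varphi_i(M)=\max\{\sum_{k\le m}y_i(k)\mid m\in\mathbf{Z}\}$, $\varepsilon_i(M)=\max\{-\sum_{k>m}y_i(k)\mid m\in\mathbf{Z}\}$; $\tilde f_iM=0$ if $\varphi_i(M)=0$, and $\tilde f_iM=A_i(m_f)^{-1}M$ otherwise, with $m_f=\min\{m\mid\varphi_i(M)=\sum_{k\le m}y_i(k)\}$; $\tilde e_iM=0$ if $\varepsilon_i(M)=0$, and $\tilde e_iM=A_i(m_e)M$ otherwise, with $m_e=\max\{m\mid\varepsilon_i(M)=-\sum_{k>m}y_i(k)\}$.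 This makes $\mathcal{M}$ a $U_q(A_n)$-crystal (known). For $1\le i\le n+1$ write $X_i(m)=Y_i(m)Y_{i-1}(m+1)^{-1}$. The set $\mathcal{M}(\lambda)$ consists of all monomials $M=\prod_{i\in I}\prod_{m=0}^{i}Y_i(-m)^{a_i^m}\in\mathcal{M}$ with $a_i^m\in\mathbf{Z}$ such that (1) $a_i^i\ge0$, $a_i^0\le0$ and $l_i=\sum_{k=0}^{n-i}a_{i+k}^i-\sum_{k=0}^{i-1}a_{n-i+1+k}^k$ for all $i\in I$; (2) $\sum_{k=0}^j a_{i+k}^k\le0$ and $\sum_{k=0}^j a_{i+k}^i\ge0$ for $1\le j\le n-1$, $1\le i\le n-j$. Tableaux. Semistandard tableaux of shape $\lambda$ have entries in $\{1,\dots,n+1\}$, weakly increasing along rows and strictly increasing down columns, with $\sum_{k=i}^n l_k$ boxes in row $i$ ($1\le i\le n$). Crystal structure (Kashiwara–Nakashima): read the boxes column by column from the rightmost column to the leftmost, each column from top to bottom, writing them left to right; under each $(i+1)$-box write $1$, under each $i$-box write $0$; successively cancel $(0,1)$ pairs to get $1$s followed by $0$s. Then $\tilde f_i$ replaces the $i$-box at the leftmost remaining $0$ by an $(i+1)$-box (and gives $0$ if no $0$ remains), $\tilde e_i$ replaces the $(i+1)$-box at the rightmost remaining $1$ by an $i$-box (and gives $0$ if no $1$ remains), $\varepsilon_i,\varphi_i$ are the numbers of remaining $1$s and $0$s, and the weight is the sum over boxes with entry $k$ of $\Lambda_k-\Lambda_{k-1}$ (with $\Lambda_0=\Lambda_{n+1}=0$).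 *)

theory Defs
  imports Main
begin

subsection \<open>Crystals of type $A_n$\<close>

text \<open>A weight is given by its coefficients in the basis of fundamental weights, so that the
  pairing of the simple coroot $h_i$ with \<open>\<mu>\<close> is \<open>\<mu> i\<close>.\<close>

type_synonym weight = "nat \<Rightarrow> int"

definition weight_lattice :: "nat \<Rightarrow> weight set" where
  "weight_lattice n = {\<mu>. \<forall>j. j \<notin> {1..n} \<longrightarrow> \<mu> j = 0}"

text \<open>The convention $\Lambda_0 = \Lambda_{n+1} = 0$ is built in.\<close>

definition fund_weight :: "nat \<Rightarrow> nat \<Rightarrow> weight" where
  "fund_weight n k = (\<lambda>j. if j = k \<and> k \<in> {1..n} then 1 else 0)"

definition cartan :: "nat \<Rightarrow> nat \<Rightarrow> nat \<Rightarrow> int" where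
  "cartan n i j =
    (if i \<in> {1..n} \<and> j \<in> {1..n}
     then if i = j then 2 else if i = j + 1 \<or> j = i + 1 then - 1 else 0
     else 0)"

definition simple_root :: "nat \<Rightarrow> nat \<Rightarrow> weight" where
  "simple_root n i = (\<lambda>j. cartan n j i)"

text \<open>In \<open>ceps\<close> and \<open>cphi\<close> the value \<open>None\<close> stands for $-\infty$; in \<open>ce\<close> and \<open>cf\<close> it stands
  for the extra element $0$. The operators are only meaningful for indices in $\{1,\dots,n\}$
  and arguments in the carrier.\<close>

record 'b crystal =
  carrier :: "'b set"
  cwt :: "'b \<Rightarrow> weight"
  ceps :: "nat \<Rightarrow> 'b \<Rightarrow> int option"
  cphi :: "nat \<Rightarrow> 'b \<Rightarrow> int option"
  ce :: "nat \<Rightarrow> 'b \<Rightarrow> 'b option"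
  cf :: "nat \<Rightarrow> 'b \<Rightarrow> 'b option"

definition is_crystal :: "nat \<Rightarrow> 'b crystal \<Rightarrow> bool" where
  "is_crystal n B \<longleftrightarrow>
     (\<forall>b \<in> carrier B. cwt B b \<in> weight_lattice n) \<and>
     (\<forall>i \<in> {1..n}. \<forall>b \<in> carrier B.
        cphi B i b = map_option (\<lambda>x. x + cwt B b i) (ceps B i b) \<and>
        (\<forall>b'. ce B i b = Some b' \<longrightarrow>
           b' \<in> carrier B \<and>
           (\<forall>j. cwt B b' j = cwt B b j + simple_root n i j) \<and>
           ceps B i b' = map_option (\<lambda>x. x - 1) (ceps B i b) \<and>
           cphi B i b' = map_option (\<lambda>x. x + 1) (cphi B i b)) \<and>
        (\<forall>b'. cf B i b = Some b' \<longrightarrow>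
           b' \<in> carrier B \<and>
           (\<forall>j. cwt B b' j = cwt B b j - simple_root n i j) \<and>
           ceps B i b' = map_option (\<lambda>x. x + 1) (ceps B i b) \<and>
           cphi B i b' = map_option (\<lambda>x. x - 1) (cphi B i b)) \<and>
        (\<forall>b' \<in> carrier B. cf B i b = Some b' \<longleftrightarrow> ce B i b' = Some b) \<and>
        (cphi B i b = None \<longrightarrow> ce B i b = None \<and> cf B i b = None))"

definition crystal_iso :: "nat \<Rightarrow> 'a crystal \<Rightarrow> 'b crystal \<Rightarrow> ('a \<Rightarrow> 'b) \<Rightarrow> bool" where
  "crystal_iso n B C \<psi> \<longleftrightarrow>
     is_crystal n B \<and> is_crystal n C \<and>
     bij_betw \<psi> (carrier B) (carrier C) \<and>
     (\<forall>b \<in> carrier B. cwt C (\<psi> b) = cwt B b) \<and>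
     (\<forall>i \<in> {1..n}. \<forall>b \<in> carrier B.
        ceps C i (\<psi> b) = ceps B i b \<and>
        cphi C i (\<psi> b) = cphi B i b \<and>
        ce C i (\<psi> b) = map_option \<psi> (ce B i b) \<and>
        cf C i (\<psi> b) = map_option \<psi> (cf B i b))"


subsection \<open>Nakajima monomials\<close>

text \<open>A Laurent monomial in the $Y_i(m)$ is represented by its exponents: \<open>M i m\<close> is
  $y_i(m)$. Products of monomials are therefore pointwise sums, and inverses are pointwise
  negations.\<close>

type_synonym monomial = "nat \<Rightarrow> int \<Rightarrow> int"

definition monomials :: "nat \<Rightarrow> monomial set" where
  "monomials n =
     {M. (\<forall>i m. i \<notin> {1..n} \<longrightarrow> M i m = 0) \<and> finite {(i, m). M i m \<noteq> 0}}"

text \<open>$Y_0(m) = Y_{n+1}(m) = 1$ is built in.\<close>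

definition Y_mon :: "nat \<Rightarrow> nat \<Rightarrow> int \<Rightarrow> monomial" where
  "Y_mon n i m = (\<lambda>j k. if j = i \<and> k = m \<and> i \<in> {1..n} then 1 else 0)"

definition A_mon :: "nat \<Rightarrow> nat \<Rightarrow> int \<Rightarrow> monomial" where
  "A_mon n i m = (\<lambda>j k. Y_mon n i m j k + Y_mon n i (m + 1) j k
                        - Y_mon n (i - 1) (m + 1) j k - Y_mon n (i + 1) m j k)"

definition X_mon :: "nat \<Rightarrow> nat \<Rightarrow> int \<Rightarrow> monomial" where
  "X_mon n i m = (\<lambda>j k. Y_mon n i m j k - Y_mon n (i - 1) (m + 1) j k)"

definition mon_wt :: "nat \<Rightarrow> monomial \<Rightarrow> weight" where
  "mon_wt n M =
     (\<lambda>j. \<Sum>i = 1..n. (\<Sum>m \<in> {m. M i m \<noteq> 0}. M i m) * fund_weight n i j)"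

text \<open>The sums over $k \le m$ and $k > m$ are restricted to the (finite) support, because
  \<open>sum\<close> over an infinite index set is \<open>0\<close>.\<close>

definition sum_le :: "monomial \<Rightarrow> nat \<Rightarrow> int \<Rightarrow> int" where
  "sum_le M i m = (\<Sum>k \<in> {k. k \<le> m \<and> M i k \<noteq> 0}. M i k)"

definition sum_gt :: "monomial \<Rightarrow> nat \<Rightarrow> int \<Rightarrow> int" where
  "sum_gt M i m = (\<Sum>k \<in> {k. k > m \<and> M i k \<noteq> 0}. M i k)"

definition mon_phi :: "nat \<Rightarrow> monomial \<Rightarrow> int" where
  "mon_phi i M = Max (range (\<lambda>m. sum_le M i m))"

definition mon_eps :: "nat \<Rightarrow> monomial \<Rightarrow> int" where
  "mon_eps i M = Max (range (\<lambda>m. - sum_gt M i m))"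

text \<open>The sets of which $m_f$ is the minimum and $m_e$ the maximum may be infinite, so that
  \<open>LEAST\<close> and \<open>GREATEST\<close> are used in place of \<open>Min\<close> and \<open>Max\<close>.\<close>

definition mon_f :: "nat \<Rightarrow> nat \<Rightarrow> monomial \<Rightarrow> monomial option" where
  "mon_f n i M =
     (if mon_phi i M = 0 then None
      else let m = (LEAST m. mon_phi i M = sum_le M i m)
           in Some (\<lambda>j k. M j k - A_mon n i m j k))"

definition mon_e :: "nat \<Rightarrow> nat \<Rightarrow> monomial \<Rightarrow> monomial option" where
  "mon_e n i M =
     (if mon_eps i M = 0 then None
      else let m = (GREATEST m. mon_eps i M = - sum_gt M i m)
           in Some (\<lambda>j k. M j k + A_mon n i m j k))"

definition monomial_crystal :: "nat \<Rightarrow> monomial crystal" where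
  "monomial_crystal n =
     \<lparr> carrier = monomials n,
       cwt = mon_wt n,
       ceps = (\<lambda>i M. Some (mon_eps i M)),
       cphi = (\<lambda>i M. Some (mon_phi i M)),
       ce = mon_e n,
       cf = mon_f n \<rparr>"

text \<open>The set $\mathcal{M}(\lambda)$ for $\lambda = \sum_i l_i \Lambda_i$; here \<open>a i m\<close> is
  $a_i^m$.\<close>

definition M_set :: "nat \<Rightarrow> (nat \<Rightarrow> nat) \<Rightarrow> monomial set" where
  "M_set n l =
     {M \<in> monomials n. \<exists>a :: nat \<Rightarrow> nat \<Rightarrow> int.
        M = (\<lambda>j k. \<Sum>i = 1..n. \<Sum>m = 0..i. a i m * Y_mon n i (- int m) j k) \<and>
        (\<forall>i \<in> {1..n}.
           a i i \<ge> 0 \<and> a i 0 \<le> 0 \<and>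
           int (l i) = (\<Sum>k = 0..n - i. a (i + k) i)
                       - (\<Sum>k = 0..i - 1. a (n - i + 1 + k) k)) \<and>
        (\<forall>j \<in> {1..n - 1}. \<forall>i \<in> {1..n - j}.
           (\<Sum>k = 0..j. a (i + k) k) \<le> 0 \<and> (\<Sum>k = 0..j. a (i + k) i) \<ge> 0)}"

text \<open>The restriction of a crystal structure to a subset keeps all structure maps. That the
  subset is closed under the operators is not part of the definition; it is asserted by
  \<open>is_crystal\<close>.\<close>

definition restrict_crystal :: "'b crystal \<Rightarrow> 'b set \<Rightarrow> 'b crystal" where
  "restrict_crystal B S = B\<lparr> carrier := S \<rparr>"

definition M_crystal :: "nat \<Rightarrow> (nat \<Rightarrow> nat) \<Rightarrow> monomial crystal" where
  "M_crystal n l = restrict_crystal (monomial_crystal n) (M_set n l)"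


subsection \<open>Semistandard tableaux\<close>

text \<open>Boxes are pairs (row, column), both counted from 1. A tableau assigns an entry to every
  box; the value \<open>0\<close> outside the shape makes the representation unique.\<close>

type_synonym box = "nat \<times> nat"
type_synonym tableau = "box \<Rightarrow> nat"

definition row_length :: "nat \<Rightarrow> (nat \<Rightarrow> nat) \<Rightarrow> nat \<Rightarrow> nat" where
  "row_length n l i = (\<Sum>k = i..n. l k)"

definition shape :: "nat \<Rightarrow> (nat \<Rightarrow> nat) \<Rightarrow> box set" where
  "shape n l = {(i, c). i \<in> {1..n} \<and> c \<in> {1..row_length n l i}}"

definition ssyt :: "nat \<Rightarrow> (nat \<Rightarrow> nat) \<Rightarrow> tableau set" where
  "ssyt n l =
     {S. (\<forall>b. b \<notin> shape n l \<longrightarrow> S b = 0) \<and>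
         (\<forall>b \<in> shape n l. S b \<in> {1..n + 1}) \<and>
         (\<forall>i c. (i, c) \<in> shape n l \<and> (i, c + 1) \<in> shape n l \<longrightarrow> S (i, c) \<le> S (i, c + 1)) \<and>
         (\<forall>i c. (i, c) \<in> shape n l \<and> (i + 1, c) \<in> shape n l \<longrightarrow> S (i, c) < S (i + 1, c))}"

text \<open>Columns from right to left (the first row is the longest one), each from top to bottom.\<close>

definition reading_boxes :: "nat \<Rightarrow> (nat \<Rightarrow> nat) \<Rightarrow> box list" where
  "reading_boxes n l =
     [(i, c). c \<leftarrow> rev [1..<row_length n l 1 + 1], i \<leftarrow> [1..<n + 1], c \<le> row_length n l i]"

text \<open>Successive cancellation of $(0,1)$ pairs in a list of boxes with entries \<open>i\<close> (sign $0$)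
  and \<open>i + 1\<close> (sign $1$), working from the right end: a box with sign $0$ cancels against the
  first box remaining to its right if that one has sign $1$. The boxes that remain are those of
  a word without a factor $01$.\<close>

fun cancel :: "tableau \<Rightarrow> nat \<Rightarrow> box list \<Rightarrow> box list" where
  "cancel S i [] = []"
| "cancel S i (b # bs) =
     (case cancel S i bs of
        [] \<Rightarrow> [b]
      | c # cs \<Rightarrow> if S b = i \<and> S c = i + 1 then cs else b # c # cs)"

text \<open>\<open>cancel\<close> is a normal form for the rewriting that deletes adjacent $(0,1)$ pairs.\<close>

inductive cancel_step :: "tableau \<Rightarrow> nat \<Rightarrow> box list \<Rightarrow> box list \<Rightarrow> bool" for S i where
  "S b = i \<Longrightarrow> S c = i + 1 \<Longrightarrow> cancel_step S i (us @ b # c # vs) (us @ vs)"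

lemma cancel_step_Cons: "cancel_step S i xs ys \<Longrightarrow> cancel_step S i (x # xs) (x # ys)"
proof (induction rule: cancel_step.induct)
  case (1 b c us vs)
  then show ?case using cancel_step.intros[of S b i c "x # us" vs] by simp
qed

lemma cancel_reachable: "(cancel_step S i)\<^sup>*\<^sup>* bs (cancel S i bs)"
proof (induction bs)
  case Nil
  then show ?case by simp
next
  case (Cons b bs)
  have *: "(cancel_step S i)\<^sup>*\<^sup>* (b # bs) (b # cancel S i bs)"
    using Cons.IH
    by (induction rule: rtranclp_induct) (auto intro: rtranclp.rtrancl_into_rtrancl cancel_step_Cons)
  show ?case
  proof (cases "cancel S i bs")
    case Nil
    then show ?thesis using * by simp
  next
    case (Cons c cs)
    show ?thesis
    proof (cases "S b = i \<and> S c = i + 1")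
      case True
      then have "cancel_step S i (b # cancel S i bs) cs"
        using cancel_step.intros[of S b i c "[]" cs] Cons by simp
      then show ?thesis using * True Cons by simp
    qed (use * Cons in auto)
  qed
qed

lemma cancel_sorted:
  assumes "\<forall>b \<in> set bs. S b \<in> {i, i + 1}"
  shows "\<exists>us vs. cancel S i bs = us @ vs \<and> (\<forall>b \<in> set us. S b = i + 1) \<and> (\<forall>b \<in> set vs. S b = i)"
  using assms
proof (induction bs)
  case Nil
  then show ?case by simp
next
  case (Cons b bs)
  then obtain us vs where r: "cancel S i bs = us @ vs" "\<forall>b \<in> set us. S b = i + 1"
      "\<forall>b \<in> set vs. S b = i"
    by auto
  show ?case
  proof (cases us)
    case Nil
    show ?thesis
    proof (cases "S b = i")
      case True
      with r Nil show ?thesis by (intro exI[of _ "[]"] exI[of _ "b # vs"]) (auto split: list.splits)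
    next
      case False
      with r Nil Cons.prems show ?thesis
        by (intro exI[of _ "[b]"] exI[of _ "vs"]) (auto split: list.splits)
    qed
  next
    case (Cons c cs)
    show ?thesis
    proof (cases "S b = i")
      case True
      with r Cons show ?thesis by (intro exI[of _ "cs"] exI[of _ "vs"]) auto
    next
      case False
      with r Cons Cons.prems \<open>us = c # cs\<close> show ?thesis
        by (intro exI[of _ "b # us"] exI[of _ "vs"]) auto
    qed
  qed
qed

definition remaining :: "nat \<Rightarrow> (nat \<Rightarrow> nat) \<Rightarrow> nat \<Rightarrow> tableau \<Rightarrow> box list" where
  "remaining n l i S = cancel S i (filter (\<lambda>b. S b = i \<or> S b = i + 1) (reading_boxes n l))"

definition remaining_ones :: "nat \<Rightarrow> (nat \<Rightarrow> nat) \<Rightarrow> nat \<Rightarrow> tableau \<Rightarrow> box list" where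
  "remaining_ones n l i S = filter (\<lambda>b. S b = i + 1) (remaining n l i S)"

definition remaining_zeros :: "nat \<Rightarrow> (nat \<Rightarrow> nat) \<Rightarrow> nat \<Rightarrow> tableau \<Rightarrow> box list" where
  "remaining_zeros n l i S = filter (\<lambda>b. S b = i) (remaining n l i S)"

definition tab_f :: "nat \<Rightarrow> (nat \<Rightarrow> nat) \<Rightarrow> nat \<Rightarrow> tableau \<Rightarrow> tableau option" where
  "tab_f n l i S =
     (if remaining_zeros n l i S = [] then None
      else Some (S(hd (remaining_zeros n l i S) := i + 1)))"

definition tab_e :: "nat \<Rightarrow> (nat \<Rightarrow> nat) \<Rightarrow> nat \<Rightarrow> tableau \<Rightarrow> tableau option" where
  "tab_e n l i S =
     (if remaining_ones n l i S = [] then None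
      else Some (S(last (remaining_ones n l i S) := i)))"

definition tab_wt :: "nat \<Rightarrow> (nat \<Rightarrow> nat) \<Rightarrow> tableau \<Rightarrow> weight" where
  "tab_wt n l S =
     (\<lambda>j. \<Sum>b \<in> shape n l. fund_weight n (S b) j - fund_weight n (S b - 1) j)"

definition tableau_crystal :: "nat \<Rightarrow> (nat \<Rightarrow> nat) \<Rightarrow> tableau crystal" where
  "tableau_crystal n l =
     \<lparr> carrier = ssyt n l,
       cwt = tab_wt n l,
       ceps = (\<lambda>i S. Some (int (length (remaining_ones n l i S)))),
       cphi = (\<lambda>i S. Some (int (length (remaining_zeros n l i S)))),
       ce = tab_e n l,
       cf = tab_f n l \<rparr>"


subsection \<open>The map from tableaux to monomials\<close>

text \<open>The number $b_k^i$ of boxes with entry \<open>k\<close> in row \<open>i\<close>.\<close>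

definition row_count :: "nat \<Rightarrow> (nat \<Rightarrow> nat) \<Rightarrow> tableau \<Rightarrow> nat \<Rightarrow> nat \<Rightarrow> nat" where
  "row_count n l S k i = card {c \<in> {1..row_length n l i}. S (i, c) = k}"

definition Psi :: "nat \<Rightarrow> (nat \<Rightarrow> nat) \<Rightarrow> tableau \<Rightarrow> monomial" where
  "Psi n l S =
     (\<lambda>j m. \<Sum>i = 1..n. \<Sum>k = i..n + 1. int (row_count n l S k i) * X_mon n k (- int i) j m)"

end

theory Submission
  imports Defs
begin

text \<open>Multiplying by \<open>X\<^sub>k(-r)\<close> for every box with entry \<open>k\<close> in row \<open>r\<close> makes the partial sum
  of the exponents of \<open>Y\<^sub>i(m)\<close> over \<open>m \<le> -r\<close> equal to the number of \<open>i\<close>-boxes in the rows from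
  \<open>r\<close> on minus the number of \<open>(i+1)\<close>-boxes strictly below row \<open>r\<close>. By semistandardness this is
  also the difference of \<open>i\<close>-boxes and \<open>(i+1)\<close>-boxes in the part of the column reading that starts
  at the last \<open>i\<close>-box of row \<open>r\<close>. In the signature rule the number of remaining zeros is the
  maximal such difference over all final segments of the word, and the leftmost remaining zero
  starts the shortest segment attaining it; hence the tableau and the monomial rules agree for
  \<open>\<phi>\<^sub>i\<close> and \<open>f\<^sub>i\<close>, and the weights give \<open>\<epsilon>\<^sub>i\<close>. Since \<open>e\<^sub>i\<close> undoes \<open>f\<^sub>i\<close> on both sides, only the
  closure of semistandard tableaux under \<open>e\<^sub>i\<close> needs a separate argument. All axioms of a crystal
  are then inherited from the crystal of all monomials.\<close>

section \<open>Crystals embedded in a crystal\<close>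

text \<open>The two rules maximise over different families: one value per row against one value per
  final segment of the column reading, and most segments do not start at the last
  \<open>i\<close>-box of a row. Extremality closes this gap, without following individual
  cancellations. An \<open>i\<close> to the right of the leftmost remaining zero would give a higher
  segment, an \<open>i+1\<close> below it an equally high shorter one; so this box ends the run of
  \<open>i\<close> in its row and may be raised. A row without \<open>i\<close>-boxes is dominated
  by the row below it. Since m = -r reverses the order of the rows, the shortest maximal segment
  corresponds to the smallest maximiser.

  The bijection with \<open>M_set\<close> is proved as well. Cumulative row counts form a
  Gelfand-Tsetlin pattern. In terms of the exponents, diagonal sums are negated row counts and sums
  with fixed superscript are differences of neighbouring pattern entries. Hence the sign conditions
  say that counts are nonnegative and that the pattern interlaces, while the condition on
  \<open>l\<close> fixes the row lengths.\<close>

lemma crystalD_wt: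
  "is_crystal n C \<Longrightarrow> i \<in> {1..n} \<Longrightarrow> b \<in> carrier C \<Longrightarrow>
   cphi C i b = map_option (\<lambda>x. x + cwt C b i) (ceps C i b)"
  unfolding is_crystal_def by blast

lemma crystalD_None:
  "is_crystal n C \<Longrightarrow> i \<in> {1..n} \<Longrightarrow> b \<in> carrier C \<Longrightarrow> cphi C i b = None \<Longrightarrow>
   ce C i b = None \<and> cf C i b = None"
  unfolding is_crystal_def by blast

lemma crystalD_inv:
  "is_crystal n C \<Longrightarrow> i \<in> {1..n} \<Longrightarrow> b \<in> carrier C \<Longrightarrow> b' \<in> carrier C \<Longrightarrow>
   cf C i b = Some b' \<longleftrightarrow> ce C i b' = Some b"
  unfolding is_crystal_def by blast

lemma crystalD_e:
  "is_crystal n C \<Longrightarrow> i \<in> {1..n} \<Longrightarrow> b \<in> carrier C \<Longrightarrow> ce C i b = Some b' \<Longrightarrow>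
   (\<forall>j. cwt C b' j = cwt C b j + simple_root n i j) \<and>
   ceps C i b' = map_option (\<lambda>x. x - 1) (ceps C i b) \<and>
   cphi C i b' = map_option (\<lambda>x. x + 1) (cphi C i b)"
  unfolding is_crystal_def by blast

lemma crystalD_f:
  "is_crystal n C \<Longrightarrow> i \<in> {1..n} \<Longrightarrow> b \<in> carrier C \<Longrightarrow> cf C i b = Some b' \<Longrightarrow>
   (\<forall>j. cwt C b' j = cwt C b j - simple_root n i j) \<and>
   ceps C i b' = map_option (\<lambda>x. x + 1) (ceps C i b) \<and>
   cphi C i b' = map_option (\<lambda>x. x - 1) (cphi C i b)"
  unfolding is_crystal_def by blast

text \<open>Closure of the carrier is separated from the shifts of weight, \<open>ceps\<close> and
  \<open>cphi\<close>: on passing to a subset only closure is new, and the shifts carry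
  over.\<close>

lemma is_crystalI:
  assumes "\<And>b. b \<in> carrier C \<Longrightarrow> cwt C b \<in> weight_lattice n"
    and "\<And>i b. i \<in> {1..n} \<Longrightarrow> b \<in> carrier C \<Longrightarrow>
      cphi C i b = map_option (\<lambda>x. x + cwt C b i) (ceps C i b)"
    and "\<And>i b. i \<in> {1..n} \<Longrightarrow> b \<in> carrier C \<Longrightarrow> cphi C i b = None \<Longrightarrow>
      ce C i b = None \<and> cf C i b = None"
    and "\<And>i b b'. i \<in> {1..n} \<Longrightarrow> b \<in> carrier C \<Longrightarrow> ce C i b = Some b' \<Longrightarrow>
      b' \<in> carrier C"
    and "\<And>i b b'. i \<in> {1..n} \<Longrightarrow> b \<in> carrier C \<Longrightarrow> cf C i b = Some b' \<Longrightarrow>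
      b' \<in> carrier C"
    and "\<And>i b b'. i \<in> {1..n} \<Longrightarrow> b \<in> carrier C \<Longrightarrow> ce C i b = Some b' \<Longrightarrow>
      (\<forall>j. cwt C b' j = cwt C b j + simple_root n i j) \<and>
      ceps C i b' = map_option (\<lambda>x. x - 1) (ceps C i b) \<and>
      cphi C i b' = map_option (\<lambda>x. x + 1) (cphi C i b)"
    and "\<And>i b b'. i \<in> {1..n} \<Longrightarrow> b \<in> carrier C \<Longrightarrow> cf C i b = Some b' \<Longrightarrow>
      (\<forall>j. cwt C b' j = cwt C b j - simple_root n i j) \<and>
      ceps C i b' = map_option (\<lambda>x. x + 1) (ceps C i b) \<and>
      cphi C i b' = map_option (\<lambda>x. x - 1) (cphi C i b)"
    and "\<And>i b b'. i \<in> {1..n} \<Longrightarrow> b \<in> carrier C \<Longrightarrow> b' \<in> carrier C \<Longrightarrow>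
      cf C i b = Some b' \<longleftrightarrow> ce C i b' = Some b"
  shows "is_crystal n C"
  unfolding is_crystal_def
  by (intro conjI ballI allI impI;
      (erule (2) assms(6)[THEN conjunct1, rule_format]
        assms(6)[THEN conjunct2, THEN conjunct1] assms(6)[THEN conjunct2, THEN conjunct2]
        assms(7)[THEN conjunct1, rule_format]
        assms(7)[THEN conjunct2, THEN conjunct1] assms(7)[THEN conjunct2, THEN conjunct2]
        assms(3)[THEN conjunct1] assms(3)[THEN conjunct2] assms(4) assms(5) assms(8)
        | erule (1) assms(2) | erule assms(1)))

text \<open>The axioms travel in both directions: \<open>B\<close> receives them by pulling back
  along the injection, the image by restriction from \<open>C\<close>. Closure of \<open>B\<close>
  under the operators is the only crystal property to be checked by hand, and it also gives closure
  of the image.\<close>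

lemma crystal_iso_onto_image:
  assumes C: "is_crystal n C"
    and inj: "inj_on \<psi> (carrier B)"
    and img: "\<psi> ` carrier B = S" and S: "S \<subseteq> carrier C"
    and e_closed: "\<And>i b b'. i \<in> {1..n} \<Longrightarrow> b \<in> carrier B \<Longrightarrow> ce B i b = Some b' \<Longrightarrow> b' \<in> carrier B"
    and f_closed: "\<And>i b b'. i \<in> {1..n} \<Longrightarrow> b \<in> carrier B \<Longrightarrow> cf B i b = Some b' \<Longrightarrow> b' \<in> carrier B"
    and wt: "\<And>b. b \<in> carrier B \<Longrightarrow> cwt C (\<psi> b) = cwt B b"
    and eps: "\<And>i b. i \<in> {1..n} \<Longrightarrow> b \<in> carrier B \<Longrightarrow> ceps C i (\<psi> b) = ceps B i b"
    and phi: "\<And>i b. i \<in> {1..n} \<Longrightarrow> b \<in> carrier B \<Longrightarrow> cphi C i (\<psi> b) = cphi B i b"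
    and e: "\<And>i b. i \<in> {1..n} \<Longrightarrow> b \<in> carrier B \<Longrightarrow> ce C i (\<psi> b) = map_option \<psi> (ce B i b)"
    and f: "\<And>i b. i \<in> {1..n} \<Longrightarrow> b \<in> carrier B \<Longrightarrow> cf C i (\<psi> b) = map_option \<psi> (cf B i b)"
  shows "crystal_iso n B (restrict_crystal C S) \<psi>"
proof -
  have mem: "\<psi> b \<in> carrier C" if "b \<in> carrier B" for b
    using that img S by blast
  have e_mono: "ce C i (\<psi> b) = Some (\<psi> b')" if "i \<in> {1..n}" "b \<in> carrier B" "ce B i b = Some b'"
    for i b b' using e[OF that(1,2)] that(3) by simp
  have f_mono: "cf C i (\<psi> b) = Some (\<psi> b')" if "i \<in> {1..n}" "b \<in> carrier B" "cf B i b = Some b'"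
    for i b b' using f[OF that(1,2)] that(3) by simp
  have B: "is_crystal n B"
  proof (rule is_crystalI)
    fix b assume b: "b \<in> carrier B"
    show "cwt B b \<in> weight_lattice n"
      using C[unfolded is_crystal_def, THEN conjunct1] mem[OF b] wt[OF b] by metis
  next
    fix i b assume i: "i \<in> {1..n}" and b: "b \<in> carrier B"
    show "cphi B i b = map_option (\<lambda>x. x + cwt B b i) (ceps B i b)"
      using crystalD_wt[OF C i mem[OF b]] wt[OF b] eps[OF i b] phi[OF i b] by simp
  next
    fix i b assume i: "i \<in> {1..n}" and b: "b \<in> carrier B" and "cphi B i b = None"
    then have "ce C i (\<psi> b) = None \<and> cf C i (\<psi> b) = None"
      using crystalD_None[OF C i mem[OF b]] phi[OF i b] by simp
    then show "ce B i b = None \<and> cf B i b = None"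
      using e[OF i b] f[OF i b] by simp
  next
    fix i b b' assume i: "i \<in> {1..n}" and b: "b \<in> carrier B" and b': "ce B i b = Some b'"
    have mem': "b' \<in> carrier B" using e_closed[OF i b b'] .
    show "(\<forall>j. cwt B b' j = cwt B b j + simple_root n i j) \<and>
      ceps B i b' = map_option (\<lambda>x. x - 1) (ceps B i b) \<and>
      cphi B i b' = map_option (\<lambda>x. x + 1) (cphi B i b)"
      using crystalD_e[OF C i mem[OF b] e_mono[OF i b b']]
      unfolding wt[OF b] wt[OF mem'] eps[OF i b] eps[OF i mem'] phi[OF i b] phi[OF i mem'] .
  next
    fix i b b' assume i: "i \<in> {1..n}" and b: "b \<in> carrier B" and b': "cf B i b = Some b'"
    have mem': "b' \<in> carrier B" using f_closed[OF i b b'] .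
    show "(\<forall>j. cwt B b' j = cwt B b j - simple_root n i j) \<and>
      ceps B i b' = map_option (\<lambda>x. x + 1) (ceps B i b) \<and>
      cphi B i b' = map_option (\<lambda>x. x - 1) (cphi B i b)"
      using crystalD_f[OF C i mem[OF b] f_mono[OF i b b']]
      unfolding wt[OF b] wt[OF mem'] eps[OF i b] eps[OF i mem'] phi[OF i b] phi[OF i mem'] .
  next
    fix i b b' assume that: "i \<in> {1..n}" "b \<in> carrier B" "b' \<in> carrier B"
    have "cf C i (\<psi> b) = Some (\<psi> b') \<longleftrightarrow> ce C i (\<psi> b') = Some (\<psi> b)"
      by (rule crystalD_inv[OF C that(1) mem[OF that(2)] mem[OF that(3)]])
    \<comment> \<open>Injectivity holds on the carrier only, so closure is what allows an equation
      between images to be cancelled.\<close>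
    moreover have "cf C i (\<psi> b) = Some (\<psi> b') \<longleftrightarrow> cf B i b = Some b'"
      using f[OF that(1,2)] f_closed[OF that(1,2)] inj_onD[OF inj _ _ that(3)] by (cases "cf B i b") auto
    moreover have "ce C i (\<psi> b') = Some (\<psi> b) \<longleftrightarrow> ce B i b' = Some b"
      using e[OF that(1,3)] e_closed[OF that(1,3)] inj_onD[OF inj _ _ that(2)] by (cases "ce B i b'") auto
    ultimately show "cf B i b = Some b' \<longleftrightarrow> ce B i b' = Some b" by simp
  qed (fact e_closed, fact f_closed)
  have rs: "carrier (restrict_crystal C S) = S" "cwt (restrict_crystal C S) = cwt C"
    "ceps (restrict_crystal C S) = ceps C" "cphi (restrict_crystal C S) = cphi C"
    "ce (restrict_crystal C S) = ce C" "cf (restrict_crystal C S) = cf C"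
    by (simp_all add: restrict_crystal_def)
  have "is_crystal n (restrict_crystal C S)"
  proof (rule is_crystalI, unfold rs)
    fix M assume "M \<in> S"
    then show "cwt C M \<in> weight_lattice n"
      using C[unfolded is_crystal_def, THEN conjunct1] S by blast
  next
    fix i M M' assume i: "i \<in> {1..n}" and "M \<in> S" and M': "ce C i M = Some M'"
    then obtain b where "b \<in> carrier B" "M = \<psi> b" using img by blast
    with M' e[OF i this(1)] e_closed[OF i this(1)] show "M' \<in> S"
      unfolding img[symmetric] by (cases "ce B i b") auto
  next
    fix i M M' assume i: "i \<in> {1..n}" and "M \<in> S" and M': "cf C i M = Some M'"
    then obtain b where "b \<in> carrier B" "M = \<psi> b" using img by blast
    with M' f[OF i this(1)] f_closed[OF i this(1)] show "M' \<in> S"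
      unfolding img[symmetric] by (cases "cf B i b") auto
  qed (rule crystalD_wt[OF C] crystalD_None[OF C] crystalD_e[OF C] crystalD_f[OF C] crystalD_inv[OF C];
      use S in blast)+
  then show ?thesis
    unfolding crystal_iso_def bij_betw_def rs
    by (intro conjI ballI B inj img wt eps phi e f)
qed

section \<open>The crystal of Nakajima monomials\<close>

definition wsum :: "(int \<Rightarrow> bool) \<Rightarrow> (int \<Rightarrow> int) \<Rightarrow> int" where
  "wsum P y = (\<Sum>k | P k \<and> y k \<noteq> 0. y k)"

abbreviation fsupp :: "(int \<Rightarrow> int) \<Rightarrow> bool" where
  "fsupp y \<equiv> finite {k. y k \<noteq> 0}"

lemma sum_le_wsum: "sum_le M i m = wsum (\<lambda>k. k \<le> m) (M i)"
  by (simp add: sum_le_def wsum_def)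

text \<open>The support changes under addition. Over a common finite superset of all supports
  involved, \<open>wsum\<close> becomes an ordinary finite sum, and linearity can be read
  off.\<close>

lemma wsum_superset:
  assumes "finite F" "{k. y k \<noteq> 0} \<subseteq> F"
  shows "wsum P y = (\<Sum>k\<in>F. if P k then y k else 0)"
  unfolding wsum_def by (rule sum.mono_neutral_cong_left) (use assms in auto)

lemma wsum_add:
  assumes "fsupp y" "fsupp z"
  shows "wsum P (\<lambda>k. y k + z k) = wsum P y + wsum P z"
proof -
  let ?F = "{k. y k \<noteq> 0} \<union> {k. z k \<noteq> 0}"
  have "finite ?F" using assms by simp
  then show ?thesis
    by (subst (1 2 3) wsum_superset[of ?F]) (auto simp: sum.distrib[symmetric] intro!: sum.cong)
qed

lemma wsum_diff:
  assumes "fsupp y" "fsupp z"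
  shows "wsum P (\<lambda>k. y k - z k) = wsum P y - wsum P z"
proof -
  let ?F = "{k. y k \<noteq> 0} \<union> {k. z k \<noteq> 0}"
  have "finite ?F" using assms by simp
  then show ?thesis
    by (subst (1 2 3) wsum_superset[of ?F]) (auto simp: sum_subtractf[symmetric] intro!: sum.cong)
qed

lemma fsupp_add: "fsupp y \<Longrightarrow> fsupp z \<Longrightarrow> fsupp (\<lambda>k. y k + z k)"
  by (rule finite_subset[of _ "{k. y k \<noteq> 0} \<union> {k. z k \<noteq> 0}"]) auto

lemma fsupp_diff: "fsupp y \<Longrightarrow> fsupp z \<Longrightarrow> fsupp (\<lambda>k. y k - z k)"
  by (rule finite_subset[of _ "{k. y k \<noteq> 0} \<union> {k. z k \<noteq> 0}"]) auto

text \<open>Both claims share one induction, since additivity in the step needs finite support of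
  the partial sum.\<close>

lemma fsupp_wsum_sum:
  assumes "finite A" "\<And>b. b \<in> A \<Longrightarrow> fsupp (y b)"
  shows "fsupp (\<lambda>k. \<Sum>b\<in>A. y b k) \<and> wsum P (\<lambda>k. \<Sum>b\<in>A. y b k) = (\<Sum>b\<in>A. wsum P (y b))"
  using assms
proof (induction A rule: finite_induct)
  case empty
  then show ?case by (simp add: wsum_def)
next
  case (insert b A)
  then have "fsupp (y b)" "fsupp (\<lambda>k. \<Sum>b\<in>A. y b k)"
    "wsum P (\<lambda>k. \<Sum>b\<in>A. y b k) = (\<Sum>b\<in>A. wsum P (y b))" by auto
  then show ?case using insert.hyps fsupp_add wsum_add by simp
qed

lemma fsupp_Y: "fsupp (Y_mon n i m j)"
  by (rule finite_subset[of _ "{m}"]) (auto simp: Y_mon_def)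

lemma wsum_Y: "wsum P (Y_mon n i m j) = (if j = i \<and> i \<in> {1..n} \<and> P m then 1 else 0)"
  by (subst wsum_superset[of "{m}"]) (auto simp: Y_mon_def)

lemma fsupp_A: "fsupp (A_mon n i m j)"
  unfolding A_mon_def by (intro fsupp_diff fsupp_add fsupp_Y)

lemma wsum_A:
  "wsum P (A_mon n i m j) = wsum P (Y_mon n i m j) + wsum P (Y_mon n i (m + 1) j)
     - wsum P (Y_mon n (i - 1) (m + 1) j) - wsum P (Y_mon n (i + 1) m j)"
  unfolding A_mon_def
  by (simp only: wsum_diff[OF fsupp_diff[OF fsupp_add[OF fsupp_Y fsupp_Y] fsupp_Y] fsupp_Y]
      wsum_diff[OF fsupp_add[OF fsupp_Y fsupp_Y] fsupp_Y] wsum_add[OF fsupp_Y fsupp_Y])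

text \<open>Among the factors of A_i(m), only Y_i(m) and Y_i(m+1) have index i. The resulting steps
  0, 1, 2 are what moves a first maximiser to a last one and back.\<close>

lemma sum_le_A:
  assumes "i \<in> {1..n}"
  shows "sum_le (A_mon n i m) i k = (if k < m then 0 else if k = m then 1 else 2)"
  using assms by (auto simp: sum_le_wsum wsum_A wsum_Y)

lemma mon_wt_wsum: "mon_wt n M j = (if j \<in> {1..n} then wsum (\<lambda>_. True) (M j) else 0)"
proof -
  have "mon_wt n M j = (\<Sum>i = 1..n. if i = j then \<Sum>m | M i m \<noteq> 0. M i m else 0)"
    unfolding mon_wt_def by (rule sum.cong) (auto simp: fund_weight_def)
  then show ?thesis by (simp add: wsum_def)
qed

lemma mon_wt_A:
  assumes "i \<in> {1..n}"
  shows "mon_wt n (A_mon n i m) j = simple_root n i j"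
  using assms by (auto simp: mon_wt_wsum wsum_A wsum_Y simple_root_def cartan_def)

lemma fsupp_monomial: "M \<in> monomials n \<Longrightarrow> fsupp (M i)"
  unfolding monomials_def
  by (rule finite_subset[of _ "snd ` {(i, m). M i m \<noteq> 0}"]) (force, simp)

lemma Y_mon_monomial: "Y_mon n i m \<in> monomials n"
proof -
  have "{(j, k). Y_mon n i m j k \<noteq> 0} \<subseteq> {(i, m)}" by (auto simp: Y_mon_def)
  then have "finite {(j, k). Y_mon n i m j k \<noteq> 0}" by (rule finite_subset) simp
  then show ?thesis unfolding monomials_def by (auto simp: Y_mon_def)
qed

lemma add_monomial:
  assumes "M \<in> monomials n" "N \<in> monomials n"
  shows "(\<lambda>j k. M j k + N j k) \<in> monomials n"
proof -
  have "{(j, k). M j k + N j k \<noteq> 0} \<subseteq> {(j, k). M j k \<noteq> 0} \<union> {(j, k). N j k \<noteq> 0}" by auto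
  then show ?thesis using assms unfolding monomials_def by (auto dest: finite_subset)
qed

lemma diff_monomial:
  assumes "M \<in> monomials n" "N \<in> monomials n"
  shows "(\<lambda>j k. M j k - N j k) \<in> monomials n"
proof -
  have "{(j, k). M j k - N j k \<noteq> 0} \<subseteq> {(j, k). M j k \<noteq> 0} \<union> {(j, k). N j k \<noteq> 0}" by auto
  then show ?thesis using assms unfolding monomials_def by (auto dest: finite_subset)
qed

lemma sum_monomial:
  assumes "finite B" "\<And>b. b \<in> B \<Longrightarrow> M b \<in> monomials n"
  shows "(\<lambda>j k. \<Sum>b\<in>B. M b j k) \<in> monomials n"
  using assms by (induction B rule: finite_induct) (auto simp: add_monomial, simp add: monomials_def)

lemma A_mon_monomial: "A_mon n i m \<in> monomials n"
  unfolding A_mon_def by (intro diff_monomial add_monomial Y_mon_monomial)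

lemma X_mon_monomial: "X_mon n i m \<in> monomials n"
  unfolding X_mon_def by (intro diff_monomial Y_mon_monomial)

section \<open>Maximisers of partial sums and the operators they define\<close>

definition first_max :: "(int \<Rightarrow> int) \<Rightarrow> int \<Rightarrow> bool" where
  "first_max P m \<longleftrightarrow> (\<forall>k. P k \<le> P m) \<and> (\<forall>k<m. P k < P m)"

definition last_max :: "(int \<Rightarrow> int) \<Rightarrow> int \<Rightarrow> bool" where
  "last_max P m \<longleftrightarrow> (\<forall>k. P k \<le> P m) \<and> (\<forall>k>m. P k < P m)"

lemma sum_le_low:
  assumes "fsupp (M i)"
  obtains m0 where "\<And>m. m \<le> m0 \<Longrightarrow> sum_le M i m = 0"
proof -
  obtain m0 where m0: "\<And>k. M i k \<noteq> 0 \<Longrightarrow> m0 < k"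
  proof -
    obtain b where b: "\<forall>k \<in> {k. M i k \<noteq> 0}. b \<le> k"
      using bdd_below_finite[OF assms] unfolding bdd_below_def by blast
    show thesis by (rule that[of "b - 1"]) (use b in force)
  qed
  have "sum_le M i m = 0" if "m \<le> m0" for m
  proof -
    have "{k. k \<le> m \<and> M i k \<noteq> 0} = {}" using m0 that by fastforce
    then show ?thesis by (simp only: sum_le_def sum.empty)
  qed
  then show thesis using that by blast
qed

lemma sum_le_high:
  assumes "fsupp (M i)"
  obtains m0 where "\<And>m. m0 \<le> m \<Longrightarrow> sum_le M i m = wsum (\<lambda>_. True) (M i)"
proof -
  obtain m0 where m0: "\<And>k. M i k \<noteq> 0 \<Longrightarrow> k \<le> m0"
    using bdd_above_finite[OF assms] unfolding bdd_above_def by blast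
  have "sum_le M i m = wsum (\<lambda>_. True) (M i)" if "m0 \<le> m" for m
  proof -
    have "{k. k \<le> m \<and> M i k \<noteq> 0} = {k. True \<and> M i k \<noteq> 0}" using m0 that by fastforce
    then show ?thesis by (simp only: sum_le_def wsum_def)
  qed
  then show thesis using that by blast
qed

lemma finite_range_sum_le:
  assumes "fsupp (M i)"
  shows "finite (range (sum_le M i))"
proof -
  have "range (sum_le M i) \<subseteq> sum (M i) ` Pow {k. M i k \<noteq> 0}"
    by (auto simp: sum_le_def)
  then show ?thesis using assms by (meson finite_Pow_iff finite_imageI finite_subset)
qed

lemma sum_le_le_phi: "fsupp (M i) \<Longrightarrow> sum_le M i m \<le> mon_phi i M"
  unfolding mon_phi_def by (rule Max_ge) (auto intro: finite_range_sum_le)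

lemma phi_attained:
  assumes "fsupp (M i)"
  obtains m where "sum_le M i m = mon_phi i M"
proof -
  have "mon_phi i M \<in> range (sum_le M i)"
    unfolding mon_phi_def using Max_in[OF finite_range_sum_le[of M i, OF assms]] by blast
  then show thesis using that by auto
qed

lemma phi_eqI:
  assumes "fsupp (M i)" "\<And>k. sum_le M i k \<le> sum_le M i m"
  shows "mon_phi i M = sum_le M i m"
  unfolding mon_phi_def
  by (rule Max_eqI) (use assms finite_range_sum_le[of M i] in auto)

lemma sum_gt_eq:
  assumes "fsupp (M i)"
  shows "sum_gt M i m = wsum (\<lambda>_. True) (M i) - sum_le M i m"
proof -
  have "sum_gt M i m = wsum (\<lambda>k. k > m) (M i)" by (simp add: sum_gt_def wsum_def)
  moreover have "wsum (\<lambda>k. k > m) (M i) + wsum (\<lambda>k. k \<le> m) (M i) = wsum (\<lambda>_. True) (M i)"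
    by (subst (1 2 3) wsum_superset[OF assms order.refl]) (auto simp: sum.distrib[symmetric] intro!: sum.cong)
  ultimately show ?thesis by (simp add: sum_le_wsum)
qed

text \<open>As m varies, \<open>- sum_gt M i m\<close> and \<open>sum_le M i m\<close> differ by the
  constant total exponent, so both maxima are attained at the same places. Hence the e operator can
  be described by \<open>sum_le\<close> too.\<close>

lemma eps_eq_phi:
  assumes "fsupp (M i)"
  shows "mon_eps i M = mon_phi i M - wsum (\<lambda>_. True) (M i)"
proof -
  let ?T = "wsum (\<lambda>_. True) (M i)"
  obtain m where m: "sum_le M i m = mon_phi i M" using phi_attained[of M i, OF assms] .
  have eq: "(\<lambda>m. - sum_gt M i m) = (\<lambda>m. sum_le M i m - ?T)" using sum_gt_eq[of M i, OF assms] by simp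
  have "range (\<lambda>m. sum_le M i m - ?T) = (\<lambda>x. x - ?T) ` range (sum_le M i)" by auto
  then have "finite (range (\<lambda>m. sum_le M i m - ?T))"
    using finite_range_sum_le[of M i, OF assms] by simp
  then show ?thesis
    unfolding mon_eps_def eq
    by (rule Max_eqI) (use sum_le_le_phi[of M i, OF assms] m[symmetric] in auto)
qed

text \<open>The distance from the lower bound is a natural number, where least elements
  exist.\<close>

lemma ex_least_int:
  fixes P :: "int \<Rightarrow> bool"
  assumes "P m" "\<And>k. P k \<Longrightarrow> b < k"
  obtains m0 where "P m0" "\<And>k. P k \<Longrightarrow> m0 \<le> k"
proof -
  define d where "d = (LEAST d. P (b + int d))"
  have "P (b + int (nat (m - b)))" using assms(1) assms(2)[OF assms(1)] by simp
  then have "P (b + int d)" unfolding d_def by (rule LeastI)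
  moreover have "b + int d \<le> k" if "P k" for k
  proof -
    have "P (b + int (nat (k - b)))" using that assms(2)[OF that] by simp
    then have "d \<le> nat (k - b)" unfolding d_def by (rule Least_le)
    then show ?thesis using assms(2)[OF that] by linarith
  qed
  ultimately show thesis using that by blast
qed

text \<open>The test for vanishing is absorbed into the existence of a first maximiser. Partial sums
  are 0 far to the left, so a value exceeding everything before it is positive; conversely a
  positive maximum is not attained arbitrarily far left and thus has a first place.\<close>

lemma mon_f_iff:
  assumes fin: "fsupp (M i)"
  shows "mon_f n i M = Some M' \<longleftrightarrow>
    (\<exists>m. first_max (sum_le M i) m \<and> M' = (\<lambda>j k. M j k - A_mon n i m j k))"
proof -
  obtain b where b: "\<And>m. m \<le> b \<Longrightarrow> sum_le M i m = 0" using sum_le_low[of M i, OF fin] by blast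
  have *: "mon_f n i M = Some (\<lambda>j k. M j k - A_mon n i m j k)" if "first_max (sum_le M i) m" for m
  proof -
    have phi: "mon_phi i M = sum_le M i m"
      using that by (intro phi_eqI fin) (simp add: first_max_def)
    \<comment> \<open>A place that is both left of m and in the region of vanishing partial
      sums.\<close>
    have "sum_le M i (min (m - 1) b) < sum_le M i m" using that by (simp add: first_max_def)
    then have "mon_phi i M \<noteq> 0" using phi b[of "min (m - 1) b"] by simp
    moreover have "(LEAST k. mon_phi i M = sum_le M i k) = m"
      using that phi by (intro Least_equality) (auto simp: first_max_def not_less[symmetric])
    ultimately show ?thesis by (simp add: mon_f_def)
  qed
  have "\<exists>m. first_max (sum_le M i) m" if "mon_f n i M = Some M'"
  proof -
    have nz: "mon_phi i M \<noteq> 0" using that by (auto simp: mon_f_def)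
    obtain m where m: "sum_le M i m = mon_phi i M" using phi_attained[of M i, OF fin] .
    have "b < k" if "sum_le M i k = mon_phi i M" for k
      using that nz b[of k] by (cases "k \<le> b") auto
    then obtain m0 where m0: "sum_le M i m0 = mon_phi i M"
        "\<And>k. sum_le M i k = mon_phi i M \<Longrightarrow> m0 \<le> k"
      using ex_least_int[of "\<lambda>m. sum_le M i m = mon_phi i M" m b] m by blast
    have "first_max (sum_le M i) m0"
      unfolding first_max_def
    proof (intro conjI allI impI)
      fix k
      show "sum_le M i k \<le> sum_le M i m0" using sum_le_le_phi[of M i, OF fin] m0(1) by simp
      assume "k < m0"
      then show "sum_le M i k < sum_le M i m0"
        using sum_le_le_phi[of M i k, OF fin] m0(1) m0(2)[of k] by linarith
    qed
    then show ?thesis ..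
  qed
  then show ?thesis using * by (metis option.inject)
qed

lemma mon_e_iff:
  assumes fin: "fsupp (M i)"
  shows "mon_e n i M = Some M' \<longleftrightarrow>
    (\<exists>m. last_max (sum_le M i) m \<and> M' = (\<lambda>j k. M j k + A_mon n i m j k))"
proof -
  let ?T = "wsum (\<lambda>_. True) (M i)"
  obtain b where b: "\<And>m. b \<le> m \<Longrightarrow> sum_le M i m = ?T" using sum_le_high[of M i, OF fin] by blast
  have eps: "mon_eps i M = - sum_gt M i m \<longleftrightarrow> sum_le M i m = mon_phi i M" for m
    using eps_eq_phi[of M i, OF fin] sum_gt_eq[of M i, OF fin] by auto
  have *: "mon_e n i M = Some (\<lambda>j k. M j k + A_mon n i m j k)" if "last_max (sum_le M i) m" for m
  proof -
    have phi: "mon_phi i M = sum_le M i m"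
      using that by (intro phi_eqI fin) (simp add: last_max_def)
    have "sum_le M i (max (m + 1) b) < sum_le M i m" using that by (simp add: last_max_def)
    then have "mon_eps i M \<noteq> 0"
      using phi b[of "max (m + 1) b"] eps_eq_phi[of M i, OF fin] by simp
    moreover have "(GREATEST k. mon_eps i M = - sum_gt M i k) = m"
      unfolding eps
      using that phi by (intro Greatest_equality) (auto simp: last_max_def not_less[symmetric])
    ultimately show ?thesis by (simp add: mon_e_def)
  qed
  have "\<exists>m. last_max (sum_le M i) m" if "mon_e n i M = Some M'"
  proof -
    have nz: "mon_phi i M \<noteq> ?T"
      using that eps_eq_phi[of M i, OF fin] by (auto simp: mon_e_def)
    obtain m where m: "sum_le M i m = mon_phi i M" using phi_attained[of M i, OF fin] .
    \<comment> \<open>Reflection at 0 turns the greatest maximiser into a least one.\<close>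
    have "- b < k" if "sum_le M i (- k) = mon_phi i M" for k
      using that nz b[of "- k"] by (cases "b \<le> - k") auto
    then obtain m0 where m0: "sum_le M i (- m0) = mon_phi i M"
        "\<And>k. sum_le M i (- k) = mon_phi i M \<Longrightarrow> m0 \<le> k"
      using ex_least_int[of "\<lambda>m. sum_le M i (- m) = mon_phi i M" "- m" "- b"] m by auto
    have "last_max (sum_le M i) (- m0)"
      unfolding last_max_def
    proof (intro conjI allI impI)
      fix k
      show "sum_le M i k \<le> sum_le M i (- m0)" using sum_le_le_phi[of M i, OF fin] m0(1) by simp
      assume "- m0 < k"
      then show "sum_le M i k < sum_le M i (- m0)"
        using sum_le_le_phi[of M i k, OF fin] m0(1) m0(2)[of "- k"] by fastforce
    qed
    then show ?thesis ..
  qed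
  then show ?thesis using * by (metis option.inject)
qed

section \<open>How A_i(m) moves the maximisers\<close>

lemma sum_le_plus_A:
  assumes "fsupp (M i)" "i \<in> {1..n}"
  shows "sum_le (\<lambda>j k. M j k + A_mon n i m j k) i k =
    sum_le M i k + (if k < m then 0 else if k = m then 1 else 2)"
  using sum_le_A[OF assms(2), of m k] by (simp add: sum_le_wsum wsum_add[OF assms(1) fsupp_A])

lemma sum_le_minus_A:
  assumes "fsupp (M i)" "i \<in> {1..n}"
  shows "sum_le (\<lambda>j k. M j k - A_mon n i m j k) i k =
    sum_le M i k - (if k < m then 0 else if k = m then 1 else 2)"
  using sum_le_A[OF assms(2), of m k] by (simp add: sum_le_wsum wsum_diff[OF assms(1) fsupp_A])

lemma mon_wt_add:
  assumes "M \<in> monomials n" "N \<in> monomials n"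
  shows "mon_wt n (\<lambda>j k. M j k + N j k) j = mon_wt n M j + mon_wt n N j"
  using assms by (simp add: mon_wt_wsum wsum_add fsupp_monomial)

lemma mon_wt_diff:
  assumes "M \<in> monomials n" "N \<in> monomials n"
  shows "mon_wt n (\<lambda>j k. M j k - N j k) j = mon_wt n M j - mon_wt n N j"
  using assms by (simp add: mon_wt_wsum wsum_diff fsupp_monomial)

text \<open>Left of m the values are unchanged and, being integers, at most the old maximum minus 1,
  which is the new value at m; right of m they drop by 2 and fall below it. So e finds the same m
  that f has used.\<close>

lemma last_max_minus_A:
  assumes "fsupp (M i)" "i \<in> {1..n}" "first_max (sum_le M i) m"
  shows "last_max (sum_le (\<lambda>j k. M j k - A_mon n i m j k) i) m"
  unfolding last_max_def
proof (intro conjI allI impI)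
  fix k
  have "sum_le M i k \<le> sum_le M i m" "k < m \<Longrightarrow> sum_le M i k < sum_le M i m"
    using assms(3) by (auto simp: first_max_def)
  then show "sum_le (\<lambda>j k. M j k - A_mon n i m j k) i k \<le> sum_le (\<lambda>j k. M j k - A_mon n i m j k) i m"
    "m < k \<Longrightarrow> sum_le (\<lambda>j k. M j k - A_mon n i m j k) i k < sum_le (\<lambda>j k. M j k - A_mon n i m j k) i m"
    unfolding sum_le_minus_A[of M i, OF assms(1,2)] by auto
qed

lemma first_max_plus_A:
  assumes "fsupp (M i)" "i \<in> {1..n}" "last_max (sum_le M i) m"
  shows "first_max (sum_le (\<lambda>j k. M j k + A_mon n i m j k) i) m"
  unfolding first_max_def
proof (intro conjI allI impI)
  fix k
  have "sum_le M i k \<le> sum_le M i m" "m < k \<Longrightarrow> sum_le M i k < sum_le M i m"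
    using assms(3) by (auto simp: last_max_def)
  then show "sum_le (\<lambda>j k. M j k + A_mon n i m j k) i k \<le> sum_le (\<lambda>j k. M j k + A_mon n i m j k) i m"
    "k < m \<Longrightarrow> sum_le (\<lambda>j k. M j k + A_mon n i m j k) i k < sum_le (\<lambda>j k. M j k + A_mon n i m j k) i m"
    unfolding sum_le_plus_A[of M i, OF assms(1,2)] by auto
qed

lemma phi_first_max: "fsupp (M i) \<Longrightarrow> first_max (sum_le M i) m \<Longrightarrow> mon_phi i M = sum_le M i m"
  by (rule phi_eqI) (auto simp: first_max_def)

lemma phi_last_max: "fsupp (M i) \<Longrightarrow> last_max (sum_le M i) m \<Longrightarrow> mon_phi i M = sum_le M i m"
  by (rule phi_eqI) (auto simp: last_max_def)

lemma mon_eps_wt: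
  assumes "M \<in> monomials n" "i \<in> {1..n}"
  shows "mon_eps i M = mon_phi i M - mon_wt n M i"
  using eps_eq_phi[of M i, OF fsupp_monomial[OF assms(1)]] assms(2) by (simp add: mon_wt_wsum)

lemma simple_root_diag: "i \<in> {1..n} \<Longrightarrow> simple_root n i i = 2"
  by (simp add: simple_root_def cartan_def)

text \<open>Only the weight and \<open>mon_phi\<close> are followed through an operator. The change
  of \<open>mon_eps\<close> results from their difference, as the simple root pairs to 2 with its
  own coroot.\<close>

theorem is_crystal_monomial_crystal: "is_crystal n (monomial_crystal n)"
proof (rule is_crystalI, unfold monomial_crystal_def crystal.simps)
  fix M assume "M \<in> monomials n"
  show "mon_wt n M \<in> weight_lattice n" by (auto simp: weight_lattice_def mon_wt_wsum)
next
  fix i M assume "i \<in> {1..n}" "M \<in> monomials n"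
  then show "Some (mon_phi i M) = map_option (\<lambda>x. x + mon_wt n M i) (Some (mon_eps i M))"
    by (simp add: mon_eps_wt)
next
  fix i M M' assume i: "i \<in> {1..n}" and M: "M \<in> monomials n"
  note fin = fsupp_monomial[OF M, of i]
  {
    assume "mon_e n i M = Some M'"
    then obtain m where m: "last_max (sum_le M i) m"
      and M': "M' = (\<lambda>j k. M j k + A_mon n i m j k)"
      using mon_e_iff[of M i, OF fin] by blast
    show mem: "M' \<in> monomials n" unfolding M' by (intro add_monomial M A_mon_monomial)
    have wt: "mon_wt n M' j = mon_wt n M j + simple_root n i j" for j
      unfolding M' mon_wt_add[OF M A_mon_monomial] mon_wt_A[OF i] ..
    have phi: "mon_phi i M' = mon_phi i M + 1"
      using phi_first_max[OF fsupp_monomial[OF mem] first_max_plus_A[of M i, OF fin i m, folded M']]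
        phi_last_max[of M i, OF fin m] sum_le_plus_A[of M i, OF fin i, of m m, folded M'] by simp
    show "(\<forall>j. mon_wt n M' j = mon_wt n M j + simple_root n i j) \<and>
        Some (mon_eps i M') = map_option (\<lambda>x. x - 1) (Some (mon_eps i M)) \<and>
        Some (mon_phi i M') = map_option (\<lambda>x. x + 1) (Some (mon_phi i M))"
      using wt phi mon_eps_wt[OF M i] mon_eps_wt[OF mem i] simple_root_diag[OF i] by simp
  }
  {
    assume "mon_f n i M = Some M'"
    then obtain m where m: "first_max (sum_le M i) m"
      and M': "M' = (\<lambda>j k. M j k - A_mon n i m j k)"
      using mon_f_iff[of M i, OF fin] by blast
    show mem: "M' \<in> monomials n" unfolding M' by (intro diff_monomial M A_mon_monomial)
    have wt: "mon_wt n M' j = mon_wt n M j - simple_root n i j" for j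
      unfolding M' mon_wt_diff[OF M A_mon_monomial] mon_wt_A[OF i] ..
    have phi: "mon_phi i M' = mon_phi i M - 1"
      using phi_last_max[OF fsupp_monomial[OF mem] last_max_minus_A[of M i, OF fin i m, folded M']]
        phi_first_max[of M i, OF fin m] sum_le_minus_A[of M i, OF fin i, of m m, folded M'] by simp
    show "(\<forall>j. mon_wt n M' j = mon_wt n M j - simple_root n i j) \<and>
        Some (mon_eps i M') = map_option (\<lambda>x. x + 1) (Some (mon_eps i M)) \<and>
        Some (mon_phi i M') = map_option (\<lambda>x. x - 1) (Some (mon_phi i M))"
      using wt phi mon_eps_wt[OF M i] mon_eps_wt[OF mem i] simple_root_diag[OF i] by simp
  }
  assume M': "M' \<in> monomials n"
  note fin' = fsupp_monomial[OF M', of i]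
  show "mon_f n i M = Some M' \<longleftrightarrow> mon_e n i M' = Some M"
    unfolding mon_f_iff[of M i, OF fin] mon_e_iff[of M' i, OF fin']
  proof (intro iffI; elim exE conjE)
    fix m assume "first_max (sum_le M i) m" "M' = (\<lambda>j k. M j k - A_mon n i m j k)"
    with last_max_minus_A[of M i, OF fin i]
    show "\<exists>m. last_max (sum_le M' i) m \<and> M = (\<lambda>j k. M' j k + A_mon n i m j k)"
      by (intro exI[of _ m]) auto
  next
    fix m assume "last_max (sum_le M' i) m" "M = (\<lambda>j k. M' j k + A_mon n i m j k)"
    with first_max_plus_A[of M' i, OF fin' i]
    show "\<exists>m. first_max (sum_le M i) m \<and> M' = (\<lambda>j k. M j k - A_mon n i m j k)"
      by (intro exI[of _ m]) auto
  qed
qed simp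

section \<open>The signature rule\<close>

text \<open>The rule for an arbitrary list of boxes, which permits induction on final segments; the
  reading word of a shape is a special case.\<close>

definition reduced :: "tableau \<Rightarrow> nat \<Rightarrow> box list \<Rightarrow> box list" where
  "reduced S i bs = cancel S i (filter (\<lambda>b. S b = i \<or> S b = i + 1) bs)"

definition zeros :: "tableau \<Rightarrow> nat \<Rightarrow> box list \<Rightarrow> box list" where
  "zeros S i bs = filter (\<lambda>b. S b = i) (reduced S i bs)"

definition ones :: "tableau \<Rightarrow> nat \<Rightarrow> box list \<Rightarrow> box list" where
  "ones S i bs = filter (\<lambda>b. S b = i + 1) (reduced S i bs)"

text \<open>Taken over a set of boxes instead of a word, so that segments of the column reading can
  be compared with regions of the shape.\<close>

definition height :: "tableau \<Rightarrow> nat \<Rightarrow> box set \<Rightarrow> int" where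
  "height S i D = (\<Sum>b\<in>D. if S b = i then 1 else if S b = i + 1 then - 1 else 0)"

lemma reduced_eq: "reduced S i bs = ones S i bs @ zeros S i bs"
proof -
  obtain us vs where "reduced S i bs = us @ vs" "\<forall>b \<in> set us. S b = i + 1" "\<forall>b \<in> set vs. S b = i"
    using cancel_sorted[of "filter (\<lambda>b. S b = i \<or> S b = i + 1) bs" S i]
    unfolding reduced_def by auto
  then show ?thesis by (auto simp: ones_def zeros_def filter_empty_conv filter_id_conv)
qed

lemma in_ones: "b \<in> set (ones S i bs) \<Longrightarrow> S b = i + 1"
  by (simp add: ones_def)

lemma in_zeros: "b \<in> set (zeros S i bs) \<Longrightarrow> S b = i"
  by (simp add: zeros_def)

text \<open>All remaining ones precede the remaining zeros, so the head of the reduced word is a one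
  as soon as any one is left, and that head is what the new zero cancels.\<close>

lemma reduced_Cons_zero:
  assumes "S b = i"
  shows "ones S i (b # bs) = tl (ones S i bs)"
    "zeros S i (b # bs) = (if ones S i bs = [] then b # zeros S i bs else zeros S i bs)"
proof -
  have "reduced S i (b # bs) =
      (case reduced S i bs of [] \<Rightarrow> [b] | c # cs \<Rightarrow> if S c = i + 1 then cs else b # c # cs)"
    using assms by (simp add: reduced_def split: list.split)
  then have r: "reduced S i (b # bs) =
      (if ones S i bs = [] then b # zeros S i bs else tl (ones S i bs) @ zeros S i bs)"
    unfolding reduced_eq[of S i bs]
    using in_ones[of "hd (ones S i bs)" S i bs] in_zeros[of "hd (zeros S i bs)" S i bs]
    by (cases "ones S i bs"; cases "zeros S i bs") auto
  have "\<forall>c \<in> set (tl (ones S i bs)). S c = i + 1"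
    using in_ones by (metis list.set_sel(2) tl_Nil)
  then show "ones S i (b # bs) = tl (ones S i bs)"
    "zeros S i (b # bs) = (if ones S i bs = [] then b # zeros S i bs else zeros S i bs)"
    unfolding ones_def[of S i "b # bs"] zeros_def[of S i "b # bs"] r
    using assms in_zeros[of _ S i bs] by (auto simp: filter_empty_conv filter_id_conv)
qed

lemma reduced_Cons_one:
  assumes "S b = i + 1"
  shows "ones S i (b # bs) = b # ones S i bs" "zeros S i (b # bs) = zeros S i bs"
proof -
  have "reduced S i (b # bs) = b # reduced S i bs"
    using assms by (simp add: reduced_def split: list.split)
  then show "ones S i (b # bs) = b # ones S i bs" "zeros S i (b # bs) = zeros S i bs"
    using assms by (simp_all add: ones_def zeros_def)
qed

lemma reduced_Cons_other:
  assumes "S b \<noteq> i" "S b \<noteq> i + 1"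
  shows "ones S i (b # bs) = ones S i bs" "zeros S i (b # bs) = zeros S i bs"
  using assms by (simp_all add: ones_def zeros_def reduced_def)

text \<open>Each cancellation removes a zero together with a one and leaves their difference
  unchanged.\<close>

lemma height_set:
  "distinct bs \<Longrightarrow> height S i (set bs) = int (length (zeros S i bs)) - int (length (ones S i bs))"
proof (induction bs)
  case Nil
  then show ?case by (simp add: height_def zeros_def ones_def reduced_def)
next
  case (Cons b bs)
  then have "height S i (set (b # bs)) =
      (if S b = i then 1 else if S b = i + 1 then - 1 else 0) + height S i (set bs)"
    by (simp add: height_def)
  then show ?case
    using Cons
    by (cases "ones S i bs"; cases "S b = i"; cases "S b = i + 1")
      (auto simp: reduced_Cons_zero reduced_Cons_one reduced_Cons_other)
qed

section \<open>Final segments of a reading word\<close>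

definition before :: "box \<Rightarrow> box \<Rightarrow> bool" where
  "before x y \<longleftrightarrow> snd y < snd x \<or> (snd y = snd x \<and> fst x < fst y)"

text \<open>For a word sorted by \<open>before\<close> these are exactly the sets of boxes of its
  final segments, the empty one included.\<close>

definition closed_in :: "box set \<Rightarrow> box set \<Rightarrow> bool" where
  "closed_in A D \<longleftrightarrow> D \<subseteq> A \<and> (\<forall>x\<in>D. \<forall>y\<in>A. before x y \<longrightarrow> y \<in> D)"

lemma before_irrefl: "\<not> before x x" by (simp add: before_def)
lemma before_asym: "before x y \<Longrightarrow> \<not> before y x" by (auto simp: before_def)

lemma sorted_before_distinct: "sorted_wrt before bs \<Longrightarrow> distinct bs"
  by (induction bs) (auto simp: before_irrefl)

lemma closed_in_Cons:
  assumes "\<forall>y\<in>A. before x y" "x \<notin> A" "closed_in (insert x A) D"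
  shows "D = insert x A \<or> (x \<notin> D \<and> closed_in A D)"
  using assms unfolding closed_in_def by blast

text \<open>The whole word has height zeros minus ones, which is at most the number of zeros; and
  prepending a box never loses a remaining zero, so the bound survives for the shorter
  segments.\<close>

lemma height_le_zeros:
  assumes "sorted_wrt before bs" "closed_in (set bs) D"
  shows "height S i D \<le> int (length (zeros S i bs))"
  using assms
proof (induction bs)
  case Nil
  then show ?case by (simp add: closed_in_def height_def)
next
  case (Cons b bs)
  have d: "distinct (b # bs)" using Cons.prems(1) by (rule sorted_before_distinct)
  have mono: "length (zeros S i bs) \<le> length (zeros S i (b # bs))"
    by (cases "S b = i"; cases "S b = i + 1") (auto simp: reduced_Cons_zero reduced_Cons_one reduced_Cons_other)
  consider "D = set (b # bs)" | "closed_in (set bs) D"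
    using closed_in_Cons[of "set bs" b D] Cons.prems d by auto
  then show ?case
  proof cases
    case 1
    then show ?thesis using height_set[OF d] by simp
  next
    case 2
    then show ?thesis using Cons mono by force
  qed
qed

text \<open>A prepended zero survives exactly when no one is left. At that moment the height of the
  whole word equals the number of zeros, which has just grown by one and so exceeds the height of
  every shorter segment. Later letters that add no zero preserve this.\<close>

lemma hd_zeros:
  assumes "sorted_wrt before bs" "zeros S i bs = b # zs"
  shows "b \<in> set bs \<and> height S i {x \<in> set bs. x = b \<or> before b x} = int (length (zeros S i bs)) \<and>
    (\<forall>D. closed_in (set bs) D \<longrightarrow> b \<notin> D \<longrightarrow> height S i D < int (length (zeros S i bs)))"
  using assms
proof (induction bs)
  case Nil
  then show ?case by (simp add: zeros_def reduced_def)
next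
  case (Cons a bs)
  have d: "distinct (a # bs)" using Cons.prems(1) by (rule sorted_before_distinct)
  have s: "sorted_wrt before bs" "\<forall>y\<in>set bs. before a y" using Cons.prems(1) by auto
  have cl: "D = set (a # bs) \<or> (a \<notin> D \<and> closed_in (set bs) D)" if "closed_in (set (a # bs)) D" for D
    using closed_in_Cons[of "set bs" a D] that s d by auto
  show ?case
  proof (cases "S a = i \<and> ones S i bs = []")
    case True
    then have z: "zeros S i (a # bs) = a # zeros S i bs" "ones S i (a # bs) = []"
      by (simp_all add: reduced_Cons_zero)
    then have "a = b" using Cons.prems(2) by simp
    moreover have "{x \<in> set (a # bs). x = a \<or> before a x} = set (a # bs)" using s by auto
    moreover have "height S i (set (a # bs)) = int (length (zeros S i (a # bs)))"
      using height_set[OF d] z by simp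
    moreover have "height S i D < int (length (zeros S i (a # bs)))"
      if "closed_in (set (a # bs)) D" "a \<notin> D" for D
      using cl[OF that(1)] that(2) height_le_zeros[OF s(1), of D S i] z by auto
    ultimately show ?thesis by simp
  next
    case False
    then have z: "zeros S i (a # bs) = zeros S i bs"
      by (cases "S a = i"; cases "S a = i + 1") (auto simp: reduced_Cons_zero reduced_Cons_one reduced_Cons_other)
    then have "zeros S i bs = b # zs" using Cons.prems by simp
    note IH = Cons.IH[OF s(1) this]
    then have "before a b" using s by blast
    then have "\<not> before b a" "a \<noteq> b" using before_asym before_irrefl by blast+
    then have "{x \<in> set (a # bs). x = b \<or> before b x} = {x \<in> set bs. x = b \<or> before b x}" by auto
    moreover have "height S i D < int (length (zeros S i bs))"
      if "closed_in (set (a # bs)) D" "b \<notin> D" for D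
      using cl[OF that(1)] that(2) IH by auto
    ultimately show ?thesis using IH z by simp
  qed
qed

section \<open>Changing the sign of a single remaining box\<close>

lemma set_cancel: "set (cancel S i bs) \<subseteq> set bs"
  by (induction bs) (auto split: list.split)

lemma cancel_cong:
  "(\<And>x. x \<in> set bs \<Longrightarrow> S x = S' x) \<Longrightarrow> cancel S i bs = cancel S' i bs"
proof (induction bs)
  case (Cons b bs)
  then have "cancel S i bs = cancel S' i bs" by simp
  moreover have "set (cancel S i bs) \<subseteq> set bs" by (rule set_cancel)
  ultimately show ?case using Cons.prems by (auto split: list.split)
qed simp

lemma distinct_cancel: "distinct bs \<Longrightarrow> distinct (cancel S i bs)"
  using set_cancel[of S i] by (induction bs) (fastforce split: list.split)+

text \<open>The box stands on the border between remaining ones and remaining zeros. There the word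
  stays reduced whatever the sign of the box is, so no cancellation is affected.\<close>

lemma cancel_flip:
  assumes "distinct bs" "cancel S i bs = us @ b # vs"
    "\<forall>x\<in>set us. S x = i + 1" "\<forall>x\<in>set vs. S x = i"
    and T: "\<And>y. y \<noteq> b \<Longrightarrow> T y = S y"
  shows "cancel T i bs = us @ b # vs"
  using assms(1-4)
proof (induction bs arbitrary: us)
  case Nil
  then show ?case by simp
next
  case (Cons x xs)
  have same: "cancel T i xs = cancel S i xs" if "b \<notin> set xs"
    by (rule cancel_cong) (use that T in metis)
  show ?case
  proof (cases "cancel S i xs")
    case Nil
    then have "x = b" "us = []" "vs = []" using Cons.prems(2) by (auto simp: Cons_eq_append_conv)
    then show ?thesis using same Cons.prems(1) Nil by simp
  next
    case (Cons c cs)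
    note cc = this
    show ?thesis
    proof (cases "S x = i \<and> S c = i + 1")
      case True
      then have cs: "cs = us @ b # vs" using Cons.prems(2) cc by simp
      \<comment> \<open>Before \<open>x\<close> cancels it, the one \<open>c\<close> still belongs
        to the block of ones; this is why the induction generalises over \<open>us\<close>.\<close>
      have "cancel T i xs = (c # us) @ b # vs"
        by (rule Cons.IH) (use Cons.prems cc cs True in auto)
      moreover have "x \<noteq> b" using set_cancel[of S i xs] Cons.prems(1) cc cs by auto
      moreover have "c \<noteq> b" using distinct_cancel[of xs S i] Cons.prems(1) cc cs by auto
      ultimately show ?thesis using True T by simp
    next
      case False
      then have eq: "x # c # cs = us @ b # vs" using Cons.prems(2) cc by auto
      show ?thesis
      proof (cases us)
        case Nil
        then have "x = b" "vs = c # cs" using eq by auto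
        moreover from this have "c \<noteq> b" using set_cancel[of S i xs] Cons.prems(1) cc by auto
        ultimately show ?thesis using same Cons.prems(1,4) Nil cc T by auto
      next
        case (Cons y us')
        then have y: "x = y" "cancel S i xs = us' @ b # vs" using eq cc by auto
        have "cancel T i xs = us' @ b # vs"
          by (rule Cons.IH) (use Cons.prems y Cons in auto)
        moreover have "x \<noteq> b" using set_cancel[of S i xs] Cons.prems(1) y by auto
        moreover have "S x = i + 1" using Cons.prems(3) Cons y by simp
        ultimately show ?thesis using Cons y by (auto simp: T split: list.split)
      qed
    qed
  qed
qed

text \<open>The last remaining one sits on the border, so as a zero it becomes the leftmost
  remaining zero. Therefore f acts on the very box that e has changed.\<close>

lemma zeros_flip_last_one:
  assumes "distinct bs" "ones S i bs \<noteq> []"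
  defines "b \<equiv> last (ones S i bs)"
  shows "S b = i + 1" "zeros (S(b := i)) i bs = b # zeros S i bs"
proof -
  let ?S = "S(b := i)" and ?us = "butlast (ones S i bs)"
  have us: "ones S i bs = ?us @ [b]" using assms(2) by (simp add: b_def)
  have b: "b \<in> set (ones S i bs)" using assms(2) by (simp add: b_def)
  show Sb: "S b = i + 1" using in_ones[OF b] .
  have f: "filter (\<lambda>b. ?S b = i \<or> ?S b = i + 1) bs = filter (\<lambda>b. S b = i \<or> S b = i + 1) bs"
    using Sb by (intro filter_cong) auto
  have r: "reduced S i bs = ?us @ b # zeros S i bs" using reduced_eq[of S i bs] us by simp
  have usv: "\<forall>x\<in>set ?us. S x = i + 1" using in_ones by (metis in_set_butlastD)
  have "reduced ?S i bs = ?us @ b # zeros S i bs"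
    unfolding reduced_def f
    by (rule cancel_flip) (use r usv in_zeros assms(1) in \<open>auto simp: reduced_def\<close>)
  moreover have "distinct (reduced S i bs)" unfolding reduced_def using assms(1) by (intro distinct_cancel) simp
  ultimately show "zeros ?S i bs = b # zeros S i bs"
    unfolding zeros_def[of ?S] using usv in_zeros[of _ S i bs] r
    by (auto simp: filter_empty_conv filter_id_conv)
qed

lemma height_flip:
  assumes "finite D" "S b = i + 1"
  shows "height (S(b := i)) i D = height S i D + (if b \<in> D then 2 else 0)"
proof -
  have "height (S(b := i)) i D - height S i D = (\<Sum>x\<in>D. if b = x then 2 else 0)"
    unfolding height_def sum_subtractf[symmetric] using assms(2) by (intro sum.cong) auto
  then show ?thesis using assms(1) by simp
qed

text \<open>The extremal property of the leftmost zero is applied to the tableau with the flipped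
  box. Undoing the flip subtracts 2 from the heights of exactly those segments that contain the box,
  so a bound h + 2 becomes h with the box, and a strict bound h + 2 becomes h + 1 without
  it.\<close>

lemma last_ones:
  assumes "sorted_wrt before bs" "ones S i bs \<noteq> []"
  defines "b \<equiv> last (ones S i bs)"
  defines "h \<equiv> height S i {x \<in> set bs. x = b \<or> before b x}"
  shows "b \<in> set bs" "closed_in (set bs) D \<Longrightarrow> height S i D \<le> (if b \<in> D then h else h + 1)"
proof -
  have d: "distinct bs" using assms(1) by (rule sorted_before_distinct)
  note flip = zeros_flip_last_one[OF d assms(2), folded b_def]
  note hd = hd_zeros[OF assms(1) flip(2)]
  show "b \<in> set bs" using hd by blast
  have "height (S(b := i)) i {x \<in> set bs. x = b \<or> before b x} = h + 2"
    unfolding h_def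
    by (subst height_flip) (use hd flip(1) in simp_all)
  then have h: "int (length (zeros (S(b := i)) i bs)) = h + 2"
    using hd by linarith
  assume D: "closed_in (set bs) D"
  then have "finite D" by (auto simp: closed_in_def intro: finite_subset)
  then show "height S i D \<le> (if b \<in> D then h else h + 1)"
    using height_flip[of D S b i] flip(1) height_le_zeros[OF assms(1) D, of "S(b := i)" i] hd D h
    by auto
qed

section \<open>The column reading of a shape\<close>

lemma sorted_wrt_concat:
  assumes "\<And>xs. xs \<in> set xss \<Longrightarrow> sorted_wrt P xs"
    and "sorted_wrt (\<lambda>xs ys. \<forall>x\<in>set xs. \<forall>y\<in>set ys. P x y) xss"
  shows "sorted_wrt P (concat xss)"
  using assms by (induction xss) (auto simp: sorted_wrt_append)

lemma sorted_reading_boxes: "sorted_wrt before (reading_boxes n l)"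
  unfolding reading_boxes_def
proof (rule sorted_wrt_concat)
  show "sorted_wrt (\<lambda>xs ys. \<forall>x\<in>set xs. \<forall>y\<in>set ys. before x y)
      (map (\<lambda>c. concat (map (\<lambda>i. if c \<le> row_length n l i then [(i, c)] else []) [1..<n + 1]))
        (rev [1..<row_length n l 1 + 1]))"
    unfolding sorted_wrt_map sorted_wrt_rev
    by (rule sorted_wrt_mono_rel[OF _ sorted_wrt_upt]) (auto simp: before_def split: if_splits)
next
  fix xs assume "xs \<in> set (map (\<lambda>c. concat (map (\<lambda>i. if c \<le> row_length n l i then [(i, c)] else [])
      [1..<n + 1])) (rev [1..<row_length n l 1 + 1]))"
  then obtain c where xs: "xs = concat (map (\<lambda>i. if c \<le> row_length n l i then [(i, c)] else []) [1..<n + 1])"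
    by auto
  show "sorted_wrt before xs"
    unfolding xs
  proof (rule sorted_wrt_concat)
    show "sorted_wrt (\<lambda>xs ys. \<forall>x\<in>set xs. \<forall>y\<in>set ys. before x y)
      (map (\<lambda>i. if c \<le> row_length n l i then [(i, c)] else []) [1..<n + 1])"
      unfolding sorted_wrt_map
      by (rule sorted_wrt_mono_rel[OF _ sorted_wrt_upt]) (auto simp: before_def)
  qed auto
qed

lemma row_length_antimono: "i \<le> j \<Longrightarrow> row_length n l j \<le> row_length n l i"
  unfolding row_length_def by (rule sum_mono2) auto

lemma set_reading_boxes: "set (reading_boxes n l) = shape n l"
  using row_length_antimono[of 1 _ n l]
  by (fastforce simp: reading_boxes_def shape_def split: if_splits)

section \<open>Semistandard tableaux\<close>

lemma finite_shape: "finite (shape n l)"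
  by (metis List.finite_set set_reading_boxes)

lemma shape_left: "(r, c) \<in> shape n l \<Longrightarrow> 1 \<le> d \<Longrightarrow> d \<le> c \<Longrightarrow> (r, d) \<in> shape n l"
  by (auto simp: shape_def)

lemma shape_up: "(r, c) \<in> shape n l \<Longrightarrow> 1 \<le> s \<Longrightarrow> s \<le> r \<Longrightarrow> (s, c) \<in> shape n l"
  using row_length_antimono[of s r n l] by (auto simp: shape_def)

lemma shape_pos: "(r, c) \<in> shape n l \<Longrightarrow> 1 \<le> r \<and> r \<le> n \<and> 1 \<le> c"
  by (auto simp: shape_def)

lemma ssyt_outside: "S \<in> ssyt n l \<Longrightarrow> b \<notin> shape n l \<Longrightarrow> S b = 0"
  unfolding ssyt_def by blast

lemma ssyt_range: "S \<in> ssyt n l \<Longrightarrow> b \<in> shape n l \<Longrightarrow> 1 \<le> S b \<and> S b \<le> n + 1"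
  by (auto simp: ssyt_def)

lemma ssyt_row_Suc:
  "S \<in> ssyt n l \<Longrightarrow> (r, c) \<in> shape n l \<Longrightarrow> (r, c + 1) \<in> shape n l \<Longrightarrow> S (r, c) \<le> S (r, c + 1)"
  by (auto simp: ssyt_def)

lemma ssyt_col_Suc:
  "S \<in> ssyt n l \<Longrightarrow> (r, c) \<in> shape n l \<Longrightarrow> (r + 1, c) \<in> shape n l \<Longrightarrow> S (r, c) < S (r + 1, c)"
  by (auto simp: ssyt_def)

lemma ssyt_row:
  assumes S: "S \<in> ssyt n l" and "(r, d) \<in> shape n l" "1 \<le> c" "c \<le> d"
  shows "S (r, c) \<le> S (r, d)"
  using assms(4,2)
proof (induction d rule: dec_induct)
  case (step d)
  then have "(r, d) \<in> shape n l" using shape_left[OF step.prems, of d] assms(3) by simp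
  then show ?case using step ssyt_row_Suc[OF S, of r d] by simp
qed simp

lemma ssyt_col:
  assumes S: "S \<in> ssyt n l" and "(s, c) \<in> shape n l" "1 \<le> r" "r < s"
  shows "S (r, c) < S (s, c)"
proof -
  have "Suc r \<le> s" using assms by simp
  then show ?thesis
    using assms(2)
  proof (induction s rule: dec_induct)
    case base
    then show ?case using ssyt_col_Suc[OF S, of r c] shape_up[OF base, of r] assms(3) by simp
  next
    case (step s)
    then have "(s, c) \<in> shape n l" using shape_up[OF step.prems, of s] assms(3) by simp
    then show ?case using step ssyt_col_Suc[OF S, of s c] by simp
  qed
qed

lemma ssyt_ge_row:
  assumes S: "S \<in> ssyt n l" and "(r, c) \<in> shape n l"
  shows "r \<le> S (r, c)"
  using assms(2)
proof (induction r)
  case (Suc r)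
  show ?case
  proof (cases "r = 0")
    case True
    then show ?thesis using ssyt_range[OF S Suc.prems] by simp
  next
    case False
    then have "(r, c) \<in> shape n l" using shape_up[OF Suc.prems, of r] by simp
    then show ?thesis using Suc ssyt_col_Suc[OF S, of r c] by simp
  qed
qed simp

text \<open>Increasing an entry by one endangers only the inequalities to the right and below, and
  these only where they are tight.\<close>

lemma ssyt_raise:
  assumes S: "S \<in> ssyt n l" and b: "(r, c) \<in> shape n l" "S (r, c) = i" "i \<le> n"
    and right: "(r, c + 1) \<in> shape n l \<Longrightarrow> S (r, c + 1) \<noteq> i"
    and below: "(r + 1, c) \<in> shape n l \<Longrightarrow> S (r + 1, c) \<noteq> i + 1"
  shows "S((r, c) := i + 1) \<in> ssyt n l"
proof -
  have "(S((r, c) := i + 1)) (s, d) \<le> (S((r, c) := i + 1)) (s, d + 1)"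
    if "(s, d) \<in> shape n l" "(s, d + 1) \<in> shape n l" for s d
    using ssyt_row_Suc[OF S that] right b that by auto
  moreover have "(S((r, c) := i + 1)) (s, d) < (S((r, c) := i + 1)) (s + 1, d)"
    if "(s, d) \<in> shape n l" "(s + 1, d) \<in> shape n l" for s d
    using ssyt_col_Suc[OF S that] below b that by auto
  ultimately show ?thesis
    using S b unfolding ssyt_def by auto
qed

lemma ssyt_lower:
  assumes S: "S \<in> ssyt n l" and b: "(r, c) \<in> shape n l" "S (r, c) = i + 1" "1 \<le> i"
    and left: "\<And>d. c = d + 1 \<Longrightarrow> (r, d) \<in> shape n l \<Longrightarrow> S (r, d) \<noteq> i + 1"
    and above: "\<And>s. r = s + 1 \<Longrightarrow> (s, c) \<in> shape n l \<Longrightarrow> S (s, c) \<noteq> i"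
  shows "S((r, c) := i) \<in> ssyt n l"
proof -
  have "(S((r, c) := i)) (s, d) \<le> (S((r, c) := i)) (s, d + 1)"
    if "(s, d) \<in> shape n l" "(s, d + 1) \<in> shape n l" for s d
    using ssyt_row_Suc[OF S that] left[of d] b that by auto
  moreover have "(S((r, c) := i)) (s, d) < (S((r, c) := i)) (s + 1, d)"
    if "(s, d) \<in> shape n l" "(s + 1, d) \<in> shape n l" for s d
    using ssyt_col_Suc[OF S that] above[of s] b that by auto
  ultimately show ?thesis
    using S b ssyt_range[OF S b(1)] unfolding ssyt_def by auto
qed

section \<open>Segments of the column reading against row counts\<close>

definition tail_boxes :: "nat \<Rightarrow> (nat \<Rightarrow> nat) \<Rightarrow> nat \<Rightarrow> nat \<Rightarrow> box set" where
  "tail_boxes n l r c = {(s, d) \<in> shape n l. d < c \<or> (d = c \<and> r \<le> s)}"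

text \<open>The partial sum of Y_i-exponents up to m = -r. The second inequality is strict because
  an \<open>(i+1)\<close>-box in row s contributes X_{i+1}(-s), whose factor Y_i(-s+1)^{-1} sits one
  place further right.\<close>

definition row_height :: "nat \<Rightarrow> (nat \<Rightarrow> nat) \<Rightarrow> nat \<Rightarrow> tableau \<Rightarrow> nat \<Rightarrow> int" where
  "row_height n l i S r = int (card {b \<in> shape n l. S b = i \<and> r \<le> fst b})
     - int (card {b \<in> shape n l. S b = i + 1 \<and> r < fst b})"

lemma height_card:
  assumes "finite D"
  shows "height S i D = int (card {b \<in> D. S b = i}) - int (card {b \<in> D. S b = i + 1})"
proof -
  have "height S i D = (\<Sum>b\<in>D. (if S b = i then 1 else 0) - (if S b = i + 1 then 1 else 0))"
    unfolding height_def by (intro sum.cong) auto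
  also have "\<dots> = (\<Sum>b\<in>D. if S b = i then 1 else 0) - (\<Sum>b\<in>D. if S b = i + 1 then 1 else 0)"
    by (rule sum_subtractf)
  finally show ?thesis using assms by (simp add: sum.If_cases Int_def)
qed

lemma finite_tail_boxes: "finite (tail_boxes n l r c)"
  unfolding tail_boxes_def by (rule finite_subset[OF _ finite_shape]) auto

lemma closed_in_tail_boxes: "closed_in (shape n l) (tail_boxes n l r c)"
  by (auto simp: closed_in_def tail_boxes_def before_def)

lemma tail_boxes_eq:
  "b \<in> shape n l \<Longrightarrow> {x \<in> shape n l. x = b \<or> before b x} = tail_boxes n l (fst b) (snd b)"
  by (cases b) (auto simp: tail_boxes_def before_def)

text \<open>Column and row reading agree at the last \<open>i\<close>-box of a row.\<close>

lemma tail_boxes_last: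
  assumes S: "S \<in> ssyt n l" and b: "(r, c) \<in> shape n l" "S (r, c) = i"
    and last: "\<And>d. (r, d) \<in> shape n l \<Longrightarrow> S (r, d) = i \<Longrightarrow> d \<le> c"
  shows "{b \<in> tail_boxes n l r c. S b = i} = {b \<in> shape n l. S b = i \<and> r \<le> fst b}"
    and "{b \<in> tail_boxes n l r c. S b = i + 1} = {b \<in> shape n l. S b = i + 1 \<and> r < fst b}"
proof -
  have pos: "1 \<le> r" "1 \<le> c" using shape_pos[OF b(1)] by auto
  have left_above: "S (s, d) < i" if "s < r" "d \<le> c" "(s, d) \<in> shape n l" for s d
  proof -
    have "1 \<le> s" "1 \<le> d" using shape_pos[OF that(3)] by auto
    then have "(s, c) \<in> shape n l" using shape_up[OF b(1)] that by simp
    then have "S (s, d) \<le> S (s, c)" using ssyt_row[OF S] that \<open>1 \<le> d\<close> by blast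
    moreover have "S (s, c) < i" using ssyt_col[OF S b(1), of s] \<open>1 \<le> s\<close> that b by simp
    ultimately show ?thesis by simp
  qed
  have "d < c \<or> (d = c \<and> r \<le> s) \<longleftrightarrow> r \<le> s" if x: "(s, d) \<in> shape n l" "S (s, d) = i" for s d
  proof
    assume "d < c \<or> (d = c \<and> r \<le> s)"
    then show "r \<le> s" using left_above[of s d] x by fastforce
  next
    assume "r \<le> s"
    show "d < c \<or> (d = c \<and> r \<le> s)"
    proof (cases "s = r")
      case True
      then show ?thesis using last[of d] x by auto
    next
      case False
      have "d < c"
      proof (rule ccontr)
        assume "\<not> d < c"
        then have "(s, c) \<in> shape n l" "S (s, c) \<le> S (s, d)"
          using shape_left[OF x(1) pos(2)] ssyt_row[OF S x(1) pos(2)] by auto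
        then show False using ssyt_col[OF S _ pos(1), of s c] False \<open>r \<le> s\<close> b x by fastforce
      qed
      then show ?thesis ..
    qed
  qed
  then show "{b \<in> tail_boxes n l r c. S b = i} = {b \<in> shape n l. S b = i \<and> r \<le> fst b}"
    unfolding tail_boxes_def by fastforce
  have "d < c \<or> (d = c \<and> r \<le> s) \<longleftrightarrow> r < s" if x: "(s, d) \<in> shape n l" "S (s, d) = i + 1" for s d
  proof
    assume a: "d < c \<or> (d = c \<and> r \<le> s)"
    have "s \<noteq> r"
      using ssyt_row[OF S b(1), of d] shape_pos[OF x(1)] a b x by auto
    then show "r < s" using left_above[of s d] a x by fastforce
  next
    assume "r < s"
    \<comment> \<open>Above an \<open>(i+1)\<close>-box in a column to the right of c, row r would
      hold an entry at most i and at least S(r, c) = i, that is, an \<open>i\<close> beyond the last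
      one.\<close>
    have "d \<le> c"
    proof (rule ccontr)
      assume "\<not> d \<le> c"
      moreover have rd: "(r, d) \<in> shape n l" using shape_up[OF x(1)] pos \<open>r < s\<close> by simp
      moreover have "S (r, d) < i + 1" using ssyt_col[OF S x(1) pos(1) \<open>r < s\<close>] x by simp
      ultimately show False using last[of d] ssyt_row[OF S rd pos(2)] b by fastforce
    qed
    then show "d < c \<or> (d = c \<and> r \<le> s)" using \<open>r < s\<close> by auto
  qed
  then show "{b \<in> tail_boxes n l r c. S b = i + 1} = {b \<in> shape n l. S b = i + 1 \<and> r < fst b}"
    unfolding tail_boxes_def by fastforce
qed

lemma height_tail_boxes_last:
  assumes "S \<in> ssyt n l" "(r, c) \<in> shape n l" "S (r, c) = i"
    "\<And>d. (r, d) \<in> shape n l \<Longrightarrow> S (r, d) = i \<Longrightarrow> d \<le> c"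
  shows "height S i (tail_boxes n l r c) = row_height n l i S r"
  using tail_boxes_last[OF assms]
  by (simp add: height_card[OF finite_tail_boxes] row_height_def)

text \<open>Only rows containing an \<open>i\<close>-box correspond to a segment. In a row without
  one, stepping down loses no zero and may drop some ones, so the value does not decrease; below the
  shape it is 0.\<close>

lemma row_height_bound:
  assumes S: "S \<in> ssyt n l"
    and bound: "\<And>s d. r \<le> s \<Longrightarrow> (s, d) \<in> shape n l \<Longrightarrow> S (s, d) = i \<Longrightarrow>
      (\<And>d'. (s, d') \<in> shape n l \<Longrightarrow> S (s, d') = i \<Longrightarrow> d' \<le> d) \<Longrightarrow>
      height S i (tail_boxes n l s d) \<le> K"
    and "0 \<le> K"
  shows "row_height n l i S r \<le> K"
  using bound
proof (induction "n + 1 - r" arbitrary: r)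
  case 0
  then have "r > n" by simp
  then have "{b \<in> shape n l. S b = i \<and> r \<le> fst b} = {}" "{b \<in> shape n l. S b = i + 1 \<and> r < fst b} = {}"
    by (auto simp: shape_def)
  then show ?case using \<open>0 \<le> K\<close> by (simp only: row_height_def card.empty)
next
  case (Suc x)
  let ?D = "{d. (r, d) \<in> shape n l \<and> S (r, d) = i}"
  have finD: "finite ?D"
    by (rule finite_subset[of _ "snd ` shape n l"]) (force, simp add: finite_shape)
  show ?case
  proof (cases "?D = {}")
    case True
    then have "{b \<in> shape n l. S b = i \<and> r \<le> fst b} = {b \<in> shape n l. S b = i \<and> Suc r \<le> fst b}"
      by (auto simp: le_less Suc_le_eq)
    moreover have "card {b \<in> shape n l. S b = i + 1 \<and> Suc r < fst b}
        \<le> card {b \<in> shape n l. S b = i + 1 \<and> r < fst b}"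
      by (rule card_mono) (auto simp: finite_shape)
    ultimately have "row_height n l i S r \<le> row_height n l i S (Suc r)"
      by (simp add: row_height_def)
    also have "\<dots> \<le> K"
      by (rule Suc.hyps(1)) (use Suc in auto)
    finally show ?thesis .
  next
    case False
    then have "Max ?D \<in> ?D" "\<And>d. d \<in> ?D \<Longrightarrow> d \<le> Max ?D" using finD Max_in Max_ge by blast+
    then have m: "(r, Max ?D) \<in> shape n l" "S (r, Max ?D) = i"
      "\<And>d. (r, d) \<in> shape n l \<Longrightarrow> S (r, d) = i \<Longrightarrow> d \<le> Max ?D" by auto
    show ?thesis
      using Suc.prems[OF order.refl m] height_tail_boxes_last[OF S m] by simp
  qed
qed

section \<open>The boxes changed by the tableau operators\<close>

lemma remaining_eq:
  "remaining n l i S = reduced S i (reading_boxes n l)"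
  "remaining_zeros n l i S = zeros S i (reading_boxes n l)"
  "remaining_ones n l i S = ones S i (reading_boxes n l)"
  by (simp_all add: remaining_def remaining_zeros_def remaining_ones_def reduced_def zeros_def ones_def)

lemma row_height_le_zeros:
  assumes "S \<in> ssyt n l"
  shows "row_height n l i S r \<le> int (length (remaining_zeros n l i S))"
  unfolding remaining_eq
  using height_le_zeros[OF sorted_reading_boxes, of n l, unfolded set_reading_boxes, OF closed_in_tail_boxes]
  by (intro row_height_bound[OF assms]) auto

text \<open>Everything about the chosen box follows from two facts: no segment is higher than the
  one starting at it, and no segment avoiding it is as high.\<close>

lemma hd_remaining_zeros:
  assumes S: "S \<in> ssyt n l" and z: "remaining_zeros n l i S \<noteq> []" and i: "i \<in> {1..n}"
  obtains r c where "hd (remaining_zeros n l i S) = (r, c)" "(r, c) \<in> shape n l" "S (r, c) = i"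
    "S((r, c) := i + 1) \<in> ssyt n l"
    "row_height n l i S r = int (length (remaining_zeros n l i S))"
    "\<And>r'. r < r' \<Longrightarrow> row_height n l i S r' < int (length (remaining_zeros n l i S))"
proof -
  obtain r c where rc: "hd (remaining_zeros n l i S) = (r, c)" by (cases "hd (remaining_zeros n l i S)")
  then obtain zs where zs: "remaining_zeros n l i S = (r, c) # zs"
    using z by (cases "remaining_zeros n l i S") auto
  let ?Z = "int (length (remaining_zeros n l i S))" and ?U = "tail_boxes n l"
  note hz = hd_zeros[OF sorted_reading_boxes, of S i n l, folded remaining_eq, OF zs, unfolded set_reading_boxes]
  have b: "(r, c) \<in> shape n l" using hz by blast
  have Sb: "S (r, c) = i" using zs in_zeros[of "(r, c)" S i "reading_boxes n l"] unfolding remaining_eq by simp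
  have U: "height S i (?U r c) = ?Z" using hz tail_boxes_eq[OF b] by simp
  have lt: "height S i (?U s d) < ?Z" if "(r, c) \<notin> ?U s d" for s d
    using hz closed_in_tail_boxes that by blast
  have le: "height S i (?U s d) \<le> ?Z" for s d
    using height_le_zeros[OF sorted_reading_boxes, of n l, unfolded set_reading_boxes, OF closed_in_tail_boxes]
    unfolding remaining_eq by blast
  have pos: "1 \<le> r" "1 \<le> c" using shape_pos[OF b] by auto
  \<comment> \<open>Otherwise the two boxes contribute 1 and -1, and the segment starting two rows
    below the chosen box is as high while avoiding it. Segments may start outside the shape, so (r +
    2, c) need not be a box.\<close>
  have below: "S (r + 1, c) \<noteq> i + 1" if "(r + 1, c) \<in> shape n l"
  proof
    assume v: "S (r + 1, c) = i + 1"
    have notin: "(r, c) \<notin> insert (r + 1, c) (?U (r + 2) c)" "(r + 1, c) \<notin> ?U (r + 2) c"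
      by (simp_all add: tail_boxes_def)
    have "?U r c = insert (r, c) (insert (r + 1, c) (?U (r + 2) c))"
      using b that by (auto simp: tail_boxes_def)
    then have "height S i (?U r c) = height S i (insert (r, c) (insert (r + 1, c) (?U (r + 2) c)))"
      by (simp only:)
    also have "\<dots> = height S i (?U (r + 2) c)"
      unfolding height_def sum.insert[OF finite.insertI[OF finite_tail_boxes] notin(1)]
        sum.insert[OF finite_tail_boxes notin(2)]
      using v Sb by simp
    also have "\<dots> < ?Z" by (rule lt) (simp add: tail_boxes_def)
    finally show False using U by simp
  qed
  \<comment> \<open>Moving the start to (r, c + 1) adds the top of column c, with entries below i,
    and the bottom of column c + 1, where by \<open>below\<close> all entries under row r exceed i +
    1. So the single box (r, c + 1) decides, and it would raise the height beyond the
    maximum.\<close>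
  have right: "S (r, c + 1) \<noteq> i" if r1: "(r, c + 1) \<in> shape n l"
  proof
    assume v: "S (r, c + 1) = i"
    have above: "S (s, d) < i" if "s < r" "(s, d) \<in> shape n l" "d \<le> c + 1" for s d
    proof -
      have s: "1 \<le> s" "1 \<le> d" using shape_pos[OF that(2)] by auto
      have "S (s, c + 1) < i" using ssyt_col[OF S r1 s(1) that(1)] v by simp
      moreover have "S (s, d) \<le> S (s, c + 1)"
        using ssyt_row[OF S _ s(2) that(3)] shape_up[OF r1 s(1)] that(1) by simp
      ultimately show ?thesis by simp
    qed
    have under: "S (s, c + 1) > i + 1" if "r < s" "(s, c + 1) \<in> shape n l" for s
    proof -
      have r: "(r + 1, c + 1) \<in> shape n l" using shape_up[OF that(2), of "r + 1"] that(1) by simp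
      then have r': "(r + 1, c) \<in> shape n l" using shape_left pos(2) by simp
      have "S (r + 1, c) > i + 1"
        using below[OF r'] ssyt_col_Suc[OF S b r'] Sb by simp
      moreover have "S (r + 1, c) \<le> S (r + 1, c + 1)" by (rule ssyt_row_Suc[OF S r' r])
      moreover have "S (r + 1, c + 1) \<le> S (s, c + 1)"
        using ssyt_col[OF S that(2), of "r + 1"] that(1) by (cases "s = r + 1") auto
      ultimately show ?thesis by simp
    qed
    have zero: "{b \<in> ?U r (c + 1). S b = i} = insert (r, c + 1) {b \<in> ?U r c. S b = i}"
    proof (intro equalityI subsetI)
      fix x assume "x \<in> {b \<in> ?U r (c + 1). S b = i}"
      then obtain s d where x: "x = (s, d)" "(s, d) \<in> shape n l" "S (s, d) = i"
        "d < c + 1 \<or> (d = c + 1 \<and> r \<le> s)" by (auto simp: tail_boxes_def)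
      then have "r \<le> s" using above[of s d] by fastforce
      moreover have "s = r" if "d = c + 1" using under[of s] that x \<open>r \<le> s\<close> by fastforce
      ultimately show "x \<in> insert (r, c + 1) {b \<in> ?U r c. S b = i}"
        using x by (auto simp: tail_boxes_def)
    next
      fix x assume "x \<in> insert (r, c + 1) {b \<in> ?U r c. S b = i}"
      then show "x \<in> {b \<in> ?U r (c + 1). S b = i}" using v r1 by (auto simp: tail_boxes_def)
    qed
    have one: "{b \<in> ?U r (c + 1). S b = i + 1} = {b \<in> ?U r c. S b = i + 1}"
    proof (intro equalityI subsetI)
      fix x assume "x \<in> {b \<in> ?U r (c + 1). S b = i + 1}"
      then obtain s d where x: "x = (s, d)" "(s, d) \<in> shape n l" "S (s, d) = i + 1"
        "d < c + 1 \<or> (d = c + 1 \<and> r \<le> s)" by (auto simp: tail_boxes_def)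
      then have "r \<le> s" using above[of s d] by fastforce
      moreover have "d \<noteq> c + 1"
        using under[of s] x \<open>r \<le> s\<close> v by (cases "s = r") fastforce+
      ultimately show "x \<in> {b \<in> ?U r c. S b = i + 1}"
        using x by (auto simp: tail_boxes_def)
    qed (auto simp: tail_boxes_def)
    have "finite {b \<in> ?U r c. S b = i}" using finite_tail_boxes by simp
    then have "card {b \<in> ?U r (c + 1). S b = i} = card {b \<in> ?U r c. S b = i} + 1"
      unfolding zero by (simp add: tail_boxes_def)
    then have "height S i (?U r (c + 1)) = height S i (?U r c) + 1"
      unfolding height_card[OF finite_tail_boxes] one by simp
    then show False using le[of r "c + 1"] U by simp
  qed
  have last: "d \<le> c" if "(r, d) \<in> shape n l" "S (r, d) = i" for d
  proof (rule ccontr)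
    assume "\<not> d \<le> c"
    then have r1: "(r, c + 1) \<in> shape n l" using shape_left[OF that(1)] by simp
    then have "S (r, c) \<le> S (r, c + 1)" "S (r, c + 1) \<le> S (r, d)"
      using ssyt_row[OF S r1 pos(2)] ssyt_row[OF S that(1), of "c + 1"] \<open>\<not> d \<le> c\<close> by auto
    then show False using right[OF r1] that Sb by simp
  qed
  have eq: "row_height n l i S r = ?Z"
    using height_tail_boxes_last[OF S b Sb last] U by simp
  \<comment> \<open>In this form the general bound applies with K = \<open>?Z - 1\<close>,
    nonnegative since a zero remains. A segment starting at the last \<open>i\<close>-box of a row
    below r misses the chosen box and is therefore strictly lower.\<close>
  have "row_height n l i S r' \<le> ?Z - 1" if r': "r < r'" for r'
  proof (rule row_height_bound[OF S])
    show "0 \<le> ?Z - 1" using zs by simp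
    fix s d assume s: "r' \<le> s" "(s, d) \<in> shape n l" "S (s, d) = i"
      "\<And>d'. (s, d') \<in> shape n l \<Longrightarrow> S (s, d') = i \<Longrightarrow> d' \<le> d"
    have "{b \<in> ?U s d. S b = i} = {b \<in> shape n l. S b = i \<and> s \<le> fst b}"
      by (rule tail_boxes_last(1)[OF S s(2,3)]) (rule s(4))
    then have "(r, c) \<in> ?U s d \<longleftrightarrow> s \<le> r" using b Sb by (simp add: set_eq_iff) metis
    then have "(r, c) \<notin> ?U s d" using s(1) r' by simp
    then show "height S i (?U s d) \<le> ?Z - 1" using lt by fastforce
  qed
  then have "row_height n l i S r' < ?Z" if "r < r'" for r' using that by fastforce
  then show thesis
    using that[OF rc b Sb ssyt_raise[OF S b Sb _ right below] eq] i by auto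
qed

text \<open>Compared with the segment starting at the chosen box, a segment containing that box is
  no higher and one avoiding it is higher by at most 1. Each obstruction to lowering the box
  violates one of these bounds.\<close>

lemma last_remaining_ones:
  assumes S: "S \<in> ssyt n l" and o: "remaining_ones n l i S \<noteq> []" and i: "i \<in> {1..n}"
  shows "S(last (remaining_ones n l i S) := i) \<in> ssyt n l"
proof -
  obtain r c where rc: "last (remaining_ones n l i S) = (r, c)" by (cases "last (remaining_ones n l i S)")
  let ?U = "tail_boxes n l"
  note lo = last_ones[OF sorted_reading_boxes, of S i n l, folded remaining_eq, OF o, unfolded set_reading_boxes rc]
  have b: "(r, c) \<in> shape n l" by (rule lo(1))
  have Sb: "S (r, c) = i + 1" using last_in_set[OF o] in_ones[of "(r, c)" S i] rc unfolding remaining_eq by simp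
  have U: "height S i (?U s d) \<le> height S i (?U r c) + (if (r, c) \<in> ?U s d then 0 else 1)" for s d
    using lo(2)[OF closed_in_tail_boxes[of n l s d]] tail_boxes_eq[OF b] by (auto split: if_splits)
  have above: "S (s, c) \<noteq> i" if "r = s + 1" "(s, c) \<in> shape n l" for s
  proof
    assume "S (s, c) = i"
    have "(s, c) \<notin> ?U r c" using that by (simp add: tail_boxes_def)
    have "?U s c = insert (s, c) (?U r c)" using that by (auto simp: tail_boxes_def)
    then have "height S i (?U s c) = height S i (insert (s, c) (?U r c))" by (simp only:)
    also have "\<dots> = 1 + height S i (?U r c)"
      unfolding height_def sum.insert[OF finite_tail_boxes \<open>(s, c) \<notin> ?U r c\<close>]
      using \<open>S (s, c) = i\<close> by simp
    finally show False using U[of s c] b that by (simp add: tail_boxes_def)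
  qed
  \<comment> \<open>Moving the start from (r, c) to just below (r, d) discards the ones at both
    boxes and no zero. The height would grow by at least 2, where only 1 is allowed.\<close>
  have left: "S (r, d) \<noteq> i + 1" if d: "c = d + 1" "(r, d) \<in> shape n l" for d
  proof
    assume v: "S (r, d) = i + 1"
    \<comment> \<open>Such an \<open>i\<close> must lie directly above (r, d), since there is no
      integer between i and i + 1; its right neighbour is squeezed to \<open>i\<close> as well and
      contradicts \<open>above\<close>.\<close>
    have no_i: "S (s, d) \<noteq> i" if s: "s < r" "(s, d) \<in> shape n l" for s
    proof
      assume "S (s, d) = i"
      have s1: "1 \<le> s" "1 \<le> d" using shape_pos[OF s(2)] by auto
      have "(s, c) \<in> shape n l" using shape_up[OF b s1(1)] s by simp
      then have "i \<le> S (s, c)" using ssyt_row[OF S _ s1(2), of s c] d \<open>S (s, d) = i\<close> by simp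
      moreover have "S (s, c) < i + 1" using ssyt_col[OF S b s1(1) s(1)] Sb by simp
      moreover have "s + 1 = r"
      proof (rule ccontr)
        assume "s + 1 \<noteq> r"
        then have "(s + 1, d) \<in> shape n l" "s + 1 < r" using shape_up[OF d(2)] s by auto
        then have "S (s, d) < S (s + 1, d)" "S (s + 1, d) < S (r, d)"
          using ssyt_col_Suc[OF S s(2)] ssyt_col[OF S d(2), of "s + 1"] by auto
        then show False using v \<open>S (s, d) = i\<close> by simp
      qed
      ultimately show False using above[of s] \<open>(s, c) \<in> shape n l\<close> by simp
    qed
    have pos: "1 \<le> r" "1 \<le> d" using shape_pos[OF d(2)] by auto
    have zero: "{b \<in> ?U r c. S b = i} = {b \<in> ?U (r + 1) d. S b = i}"
    proof (intro equalityI subsetI)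
      fix x assume "x \<in> {b \<in> ?U r c. S b = i}"
      then obtain s e where x: "x = (s, e)" "(s, e) \<in> shape n l" "S (s, e) = i"
        "e < c \<or> (e = c \<and> r \<le> s)" by (auto simp: tail_boxes_def)
      have "e \<noteq> c"
      proof
        assume "e = c"
        then have "r \<le> s" using x by simp
        then have "i + 1 \<le> S (s, e)"
          using ssyt_col[OF S x(2) pos(1)] Sb \<open>e = c\<close> by (cases "s = r") auto
        then show False using x by simp
      qed
      then have "e \<le> d" using x d by auto
      moreover have "r < s" if "e = d" using no_i[of s] that x v by (cases s r rule: linorder_cases) auto
      ultimately show "x \<in> {b \<in> ?U (r + 1) d. S b = i}"
        using x by (auto simp: tail_boxes_def)
    qed (auto simp: tail_boxes_def d)
    have one: "insert (r, c) (insert (r, d) {b \<in> ?U (r + 1) d. S b = i + 1}) \<subseteq> {b \<in> ?U r c. S b = i + 1}"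
      using b d v Sb by (auto simp: tail_boxes_def)
    have "finite {b \<in> ?U r c. S b = i + 1}" "finite {b \<in> ?U (r + 1) d. S b = i + 1}"
      using finite_tail_boxes by simp_all
    then have "card {b \<in> ?U (r + 1) d. S b = i + 1} + 2 \<le> card {b \<in> ?U r c. S b = i + 1}"
      using card_mono[OF _ one] d by (simp add: tail_boxes_def)
    then have "height S i (?U (r + 1) d) \<ge> height S i (?U r c) + 2"
      unfolding height_card[OF finite_tail_boxes] zero by simp
    then show False using U[of "r + 1" d] by (simp split: if_splits)
  qed
  show ?thesis
    unfolding rc by (rule ssyt_lower[OF S b Sb _ left above]) (use i in auto)
qed

lemma tab_e_SomeD:
  assumes S: "S \<in> ssyt n l" and i: "i \<in> {1..n}" and e: "tab_e n l i S = Some S'"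
  shows "S' \<in> ssyt n l" "tab_f n l i S' = Some S"
proof -
  have o: "remaining_ones n l i S \<noteq> []" using e by (auto simp: tab_e_def)
  let ?b = "last (remaining_ones n l i S)"
  have S': "S' = S(?b := i)" using e o by (simp add: tab_e_def)
  show "S' \<in> ssyt n l" unfolding S' by (rule last_remaining_ones[OF S o i])
  note flip = zeros_flip_last_one[OF sorted_before_distinct[OF sorted_reading_boxes], of S i n l,
      folded remaining_eq, OF o]
  have "S(?b := i, ?b := i + 1) = S" using flip(1) by (simp add: fun_upd_idem)
  then show "tab_f n l i S' = Some S" using flip(2) by (simp add: S' tab_f_def)
qed

lemma tab_f_SomeD:
  assumes S: "S \<in> ssyt n l" and i: "i \<in> {1..n}" and f: "tab_f n l i S = Some S'"
  obtains r c where "(r, c) \<in> shape n l" "S (r, c) = i" "S' = S((r, c) := i + 1)" "S' \<in> ssyt n l"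
    "row_height n l i S r = int (length (remaining_zeros n l i S))"
    "\<And>r'. r < r' \<Longrightarrow> row_height n l i S r' < int (length (remaining_zeros n l i S))"
proof -
  have z: "remaining_zeros n l i S \<noteq> []" using f by (auto simp: tab_f_def)
  obtain r c where *: "hd (remaining_zeros n l i S) = (r, c)" "(r, c) \<in> shape n l" "S (r, c) = i"
    "S((r, c) := i + 1) \<in> ssyt n l"
    "row_height n l i S r = int (length (remaining_zeros n l i S))"
    "\<And>r'. r < r' \<Longrightarrow> row_height n l i S r' < int (length (remaining_zeros n l i S))"
    using hd_remaining_zeros[OF S z i] by blast
  have "S' = S((r, c) := i + 1)" using f z *(1) by (simp add: tab_f_def)
  then show thesis using that * by blast
qed

lemma zeros_attained:
  assumes S: "S \<in> ssyt n l" and i: "i \<in> {1..n}"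
  obtains r where "row_height n l i S r = int (length (remaining_zeros n l i S))"
proof (cases "remaining_zeros n l i S = []")
  case True
  \<comment> \<open>When no zero remains, the value 0 is attained below the last row.\<close>
  have "{b \<in> shape n l. S b = i \<and> n + 1 \<le> fst b} = {}" "{b \<in> shape n l. S b = i + 1 \<and> n + 1 < fst b} = {}"
    by (auto simp: shape_def)
  then have "row_height n l i S (n + 1) = 0" by (simp only: row_height_def card.empty)
  then show ?thesis using that True by simp
next
  case False
  then show ?thesis using hd_remaining_zeros[OF S False i] that by blast
qed

section \<open>The map to monomials\<close>

lemma shape_Sigma: "shape n l = Sigma {1..n} (\<lambda>i. {1..row_length n l i})"
  by (auto simp: shape_def)

text \<open>As a product over boxes the monomial changes by one factor when one box changes. The
  range k \<ge> i loses nothing, because column strictness forces entries of row i to be at least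
  i.\<close>

lemma Psi_boxes:
  assumes S: "S \<in> ssyt n l"
  shows "Psi n l S = (\<lambda>j m. \<Sum>b\<in>shape n l. X_mon n (S b) (- int (fst b)) j m)"
proof (intro ext)
  fix j m
  have "(\<Sum>k = i..n + 1. int (row_count n l S k i) * X_mon n k (- int i) j m) =
      (\<Sum>c = 1..row_length n l i. X_mon n (S (i, c)) (- int i) j m)" if "i \<in> {1..n}" for i
  proof -
    have "S (i, c) \<in> {i..n + 1}" if "c \<in> {1..row_length n l i}" for c
      using ssyt_ge_row[OF S, of i c] ssyt_range[OF S, of "(i, c)"] that \<open>i \<in> {1..n}\<close>
      by (auto simp: shape_def)
    then have "(\<Sum>c = 1..row_length n l i. X_mon n (S (i, c)) (- int i) j m) =
        (\<Sum>k = i..n + 1. \<Sum>c\<in>{c \<in> {1..row_length n l i}. S (i, c) = k}. X_mon n (S (i, c)) (- int i) j m)"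
      by (intro sum.group[symmetric]) auto
    also have "\<dots> = (\<Sum>k = i..n + 1. int (row_count n l S k i) * X_mon n k (- int i) j m)"
      by (intro sum.cong refl) (simp add: row_count_def)
    finally show ?thesis by simp
  qed
  then have "Psi n l S j m = (\<Sum>i = 1..n. \<Sum>c = 1..row_length n l i. X_mon n (S (i, c)) (- int i) j m)"
    unfolding Psi_def by (rule sum.cong[OF refl])
  also have "\<dots> = (\<Sum>b\<in>shape n l. X_mon n (S b) (- int (fst b)) j m)"
    unfolding shape_Sigma by (subst sum.Sigma) (auto intro!: sum.cong)
  finally show "Psi n l S j m = (\<Sum>b\<in>shape n l. X_mon n (S b) (- int (fst b)) j m)" .
qed

lemma Psi_monomial: "S \<in> ssyt n l \<Longrightarrow> Psi n l S \<in> monomials n"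
  unfolding Psi_boxes by (intro sum_monomial finite_shape X_mon_monomial)

lemma wsum_X:
  "wsum P (X_mon n k m j) = (if j = k \<and> k \<in> {1..n} \<and> P m then 1 else 0)
     - (if j = k - 1 \<and> k - 1 \<in> {1..n} \<and> P (m + 1) then 1 else 0)"
  unfolding X_mon_def by (simp only: wsum_diff[OF fsupp_Y fsupp_Y] wsum_Y)

lemma wsum_Psi:
  assumes "S \<in> ssyt n l"
  shows "wsum P (Psi n l S j) = (\<Sum>b\<in>shape n l. wsum P (X_mon n (S b) (- int (fst b)) j))"
  unfolding Psi_boxes[OF assms]
  by (rule fsupp_wsum_sum[THEN conjunct2]) (rule finite_shape, rule fsupp_monomial[OF X_mon_monomial])

lemma mon_wt_Psi:
  assumes S: "S \<in> ssyt n l"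
  shows "mon_wt n (Psi n l S) = tab_wt n l S"
proof
  fix j
  show "mon_wt n (Psi n l S) j = tab_wt n l S j"
  proof (cases "j \<in> {1..n}")
    case True
    then show ?thesis
      unfolding mon_wt_wsum wsum_Psi[OF S] wsum_X tab_wt_def fund_weight_def by simp
  next
    case False
    then show ?thesis
      unfolding mon_wt_wsum tab_wt_def fund_weight_def by (subst sum.neutral) auto
  qed
qed

text \<open>For m > 0 the value \<open>nat (- m)\<close> is 0. Rows start at 1, so all exponents sit
  at places m \<le> 0, and \<open>row_height\<close> at 0 counts every box.\<close>

lemma sum_le_Psi:
  assumes S: "S \<in> ssyt n l" and i: "i \<in> {1..n}"
  shows "sum_le (Psi n l S) i m = row_height n l i S (nat (- m))"
proof -
  have "sum_le (Psi n l S) i m = (\<Sum>b\<in>shape n l. (if S b = i \<and> nat (- m) \<le> fst b then 1 else 0)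
      - (if S b = i + 1 \<and> nat (- m) < fst b then 1 else 0))"
    unfolding sum_le_wsum wsum_Psi[OF S] wsum_X
  proof (intro sum.cong refl arg_cong2[of _ _ _ _ "(-)"] if_cong)
    fix b assume "b \<in> shape n l"
    then have "1 \<le> fst b" using shape_pos by (cases b) auto
    then show "(i = S b - 1 \<and> S b - 1 \<in> {1..n} \<and> - int (fst b) + 1 \<le> m) =
        (S b = i + 1 \<and> nat (- m) < fst b)"
      using i by auto
  qed (use i in auto)
  also have "\<dots> = row_height n l i S (nat (- m))"
    unfolding row_height_def sum_subtractf
    using finite_shape[of n l] by (simp add: sum.If_cases Int_def conj_ac)
  finally show ?thesis .
qed

lemma mon_phi_Psi:
  assumes S: "S \<in> ssyt n l" and i: "i \<in> {1..n}"
  shows "mon_phi i (Psi n l S) = int (length (remaining_zeros n l i S))"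
proof -
  obtain r where r: "row_height n l i S r = int (length (remaining_zeros n l i S))"
    using zeros_attained[OF S i] .
  have "mon_phi i (Psi n l S) = sum_le (Psi n l S) i (- int r)"
    using r row_height_le_zeros[OF S]
    by (intro phi_eqI fsupp_monomial[OF Psi_monomial[OF S]]) (simp add: sum_le_Psi[OF S i])
  then show ?thesis using r by (simp add: sum_le_Psi[OF S i])
qed

lemma tab_wt_height:
  assumes "S \<in> ssyt n l" "i \<in> {1..n}"
  shows "tab_wt n l S i = int (length (remaining_zeros n l i S)) - int (length (remaining_ones n l i S))"
proof -
  have "tab_wt n l S i = height S i (shape n l)"
    unfolding tab_wt_def height_def fund_weight_def using assms(2) by (intro sum.cong) auto
  then show ?thesis
    using height_set[OF sorted_before_distinct[OF sorted_reading_boxes], of S i n l]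
    by (simp add: remaining_eq set_reading_boxes)
qed

lemma mon_eps_Psi:
  assumes S: "S \<in> ssyt n l" and i: "i \<in> {1..n}"
  shows "mon_eps i (Psi n l S) = int (length (remaining_ones n l i S))"
  using mon_eps_wt[OF Psi_monomial[OF S] i] mon_phi_Psi[OF S i] tab_wt_height[OF S i]
  by (simp add: mon_wt_Psi[OF S])

text \<open>This is the identity X_{i+1}(m) = X_i(m) A_i(m)^{-1}, used at m = -r for the one box
  that changes.\<close>

lemma Psi_raise:
  assumes S: "S \<in> ssyt n l" and S': "S((r, c) := i + 1) \<in> ssyt n l"
    and b: "(r, c) \<in> shape n l" "S (r, c) = i"
  shows "Psi n l (S((r, c) := i + 1)) = (\<lambda>j k. Psi n l S j k - A_mon n i (- int r) j k)"
proof (intro ext)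
  fix j k
  let ?b = "(r, c)"
  have "(\<Sum>x\<in>shape n l. X_mon n ((S(?b := i + 1)) x) (- int (fst x)) j k)
      = X_mon n (i + 1) (- int r) j k + (\<Sum>x\<in>shape n l - {?b}. X_mon n (S x) (- int (fst x)) j k)"
    by (subst sum.remove[OF finite_shape b(1)]) (auto intro!: sum.cong)
  moreover have "(\<Sum>x\<in>shape n l. X_mon n (S x) (- int (fst x)) j k)
      = X_mon n i (- int r) j k + (\<Sum>x\<in>shape n l - {?b}. X_mon n (S x) (- int (fst x)) j k)"
    by (subst sum.remove[OF finite_shape b(1)]) (simp add: b(2))
  ultimately show "Psi n l (S(?b := i + 1)) j k = Psi n l S j k - A_mon n i (- int r) j k"
    unfolding Psi_boxes[OF S] Psi_boxes[OF S'] by (simp add: X_mon_def A_mon_def)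
qed

text \<open>The tableau rule selects the lowest row of maximal \<open>row_height\<close>. Lower rows
  belong to smaller m, so this row gives the first maximiser.\<close>

lemma mon_f_Psi:
  assumes S: "S \<in> ssyt n l" and i: "i \<in> {1..n}"
  shows "mon_f n i (Psi n l S) = map_option (Psi n l) (tab_f n l i S)"
proof (cases "tab_f n l i S")
  case None
  then have "mon_phi i (Psi n l S) = 0"
    using mon_phi_Psi[OF S i] by (simp add: tab_f_def split: if_splits)
  then show ?thesis using None by (simp add: mon_f_def)
next
  case (Some S')
  obtain r c where *: "(r, c) \<in> shape n l" "S (r, c) = i" "S' = S((r, c) := i + 1)" "S' \<in> ssyt n l"
    "row_height n l i S r = int (length (remaining_zeros n l i S))"
    "\<And>r'. r < r' \<Longrightarrow> row_height n l i S r' < int (length (remaining_zeros n l i S))"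
    using tab_f_SomeD[OF S i Some] by blast
  have "first_max (sum_le (Psi n l S) i) (- int r)"
    unfolding first_max_def sum_le_Psi[OF S i] using *(5,6) row_height_le_zeros[OF S] by simp
  then have "mon_f n i (Psi n l S) = Some (Psi n l S')"
    using mon_f_iff[of "Psi n l S" i, OF fsupp_monomial[OF Psi_monomial[OF S]]] Psi_raise[OF S *(4)[unfolded *(3)] *(1,2)] *(3)
    by blast
  then show ?thesis using Some by simp
qed

lemma mon_e_Psi:
  assumes S: "S \<in> ssyt n l" and i: "i \<in> {1..n}"
  shows "mon_e n i (Psi n l S) = map_option (Psi n l) (tab_e n l i S)"
proof (cases "tab_e n l i S")
  case None
  then have "mon_eps i (Psi n l S) = 0"
    using mon_eps_Psi[OF S i] by (simp add: tab_e_def split: if_splits)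
  then show ?thesis using None by (simp add: mon_e_def)
next
  case (Some S')
  note S' = tab_e_SomeD[OF S i Some]
  have "mon_f n i (Psi n l S') = Some (Psi n l S)" using mon_f_Psi[OF S'(1) i] S'(2) by simp
  then have "mon_e n i (Psi n l S) = Some (Psi n l S')"
    using crystalD_inv[OF is_crystal_monomial_crystal i, of "Psi n l S'" "Psi n l S"]
      Psi_monomial[OF S] Psi_monomial[OF S'(1)] by (simp add: monomial_crystal_def)
  then show ?thesis using Some by simp
qed

section \<open>The image of the map\<close>

lemma row_length_out: "n < r \<Longrightarrow> row_length n l r = 0"
  by (simp add: row_length_def)

lemma row_length_Suc: "r \<le> n \<Longrightarrow> row_length n l r = l r + row_length n l (Suc r)"
  unfolding row_length_def by (rule sum.atLeast_Suc_atMost)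

text \<open>As k and r vary, these are the entries of the Gelfand-Tsetlin pattern of the tableau:
  the row lengths of the part with entries at most k.\<close>

definition row_le :: "nat \<Rightarrow> (nat \<Rightarrow> nat) \<Rightarrow> tableau \<Rightarrow> nat \<Rightarrow> nat \<Rightarrow> nat" where
  "row_le n l S k r = card {c \<in> {1..row_length n l r}. S (r, c) \<le> k}"

lemma row_le_Suc: "row_le n l S (Suc k) r = row_le n l S k r + row_count n l S (Suc k) r"
proof -
  let ?A = "{c \<in> {1..row_length n l r}. S (r, c) \<le> k}"
    and ?B = "{c \<in> {1..row_length n l r}. S (r, c) = Suc k}"
  have "{c \<in> {1..row_length n l r}. S (r, c) \<le> Suc k} = ?A \<union> ?B"
    by auto
  moreover have "card (?A \<union> ?B) = card ?A + card ?B"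
    by (rule card_Un_disjoint) auto
  ultimately show ?thesis by (simp only: row_le_def row_count_def)
qed

lemma row_count_zero:
  assumes S: "S \<in> ssyt n l" and k: "1 \<le> k" "k < r \<or> r = 0"
  shows "row_count n l S k r = 0"
proof -
  have "S (r, c) \<noteq> k" for c
    using ssyt_ge_row[OF S, of r c] ssyt_outside[OF S, of "(r, c)"] k shape_pos[of r c n l]
    by (cases "(r, c) \<in> shape n l") auto
  then show ?thesis by (simp add: row_count_def)
qed

lemma row_le_zero:
  assumes S: "S \<in> ssyt n l" and k: "1 \<le> r" "k < r"
  shows "row_le n l S k r = 0"
proof -
  have "\<not> S (r, c) \<le> k" if "c \<in> {1..row_length n l r}" for c
  proof -
    have "r \<le> n" using that row_length_out[of n r l] by (cases "r \<le> n") auto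
    then have "(r, c) \<in> shape n l" using that k by (simp add: shape_def)
    then show ?thesis using ssyt_ge_row[OF S, of r c] k by simp
  qed
  then have "{c \<in> {1..row_length n l r}. S (r, c) \<le> k} = {}" by blast
  then show ?thesis by (simp only: row_le_def card.empty)
qed

lemma row_le_full:
  assumes S: "S \<in> ssyt n l"
  shows "row_le n l S (n + 1) r = row_length n l r"
proof -
  have "S b \<le> n + 1" for b
    using ssyt_range[OF S, of b] ssyt_outside[OF S, of b] by (cases "b \<in> shape n l") auto
  then have "{c \<in> {1..row_length n l r}. S (r, c) \<le> n + 1} = {1..row_length n l r}" by blast
  then show ?thesis by (simp only: row_le_def card_atLeastAtMost)
qed

text \<open>One half of the interlacing condition, and the form in which column strictness enters:
  above an entry at most k + 1 stands an entry at most k.\<close>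

lemma row_le_diag:
  assumes S: "S \<in> ssyt n l" and r: "1 \<le> r"
  shows "row_le n l S (Suc k) (Suc r) \<le> row_le n l S k r"
  unfolding row_le_def
proof (rule card_mono)
  show "{c \<in> {1..row_length n l (Suc r)}. S (Suc r, c) \<le> Suc k} \<subseteq> {c \<in> {1..row_length n l r}. S (r, c) \<le> k}"
  proof
    fix c assume c: "c \<in> {c \<in> {1..row_length n l (Suc r)}. S (Suc r, c) \<le> Suc k}"
    then have "Suc r \<le> n" using row_length_out[of n "Suc r" l] by (cases "Suc r \<le> n") auto
    then have sh: "(Suc r, c) \<in> shape n l" using c by (simp add: shape_def)
    then have sh': "(r, c) \<in> shape n l" using shape_up r by simp
    then have "S (r, c) < S (Suc r, c)" using ssyt_col_Suc[OF S, of r c] sh by simp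
    then show "c \<in> {c \<in> {1..row_length n l r}. S (r, c) \<le> k}" using sh' c by (simp add: shape_def)
  qed
qed simp

lemma row_count_shape:
  assumes "S \<in> ssyt n l" "1 \<le> k"
  shows "row_count n l S k r = card {b \<in> shape n l. S b = k \<and> fst b = r}"
proof -
  have "{b \<in> shape n l. S b = k \<and> fst b = r} = Pair r ` {c \<in> {1..row_length n l r}. S (r, c) = k}"
  proof (intro equalityI subsetI)
    fix b assume "b \<in> Pair r ` {c \<in> {1..row_length n l r}. S (r, c) = k}"
    then have "S b = k" "fst b = r" by auto
    moreover have "b \<in> shape n l" using ssyt_outside[OF assms(1), of b] calculation(1) assms(2) by auto
    ultimately show "b \<in> {b \<in> shape n l. S b = k \<and> fst b = r}" by simp
  qed (auto simp: shape_def)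
  then show ?thesis unfolding row_count_def by (simp add: card_image inj_on_def)
qed

text \<open>Y_j(-t) occurs in X_j(-t), and inversely in X_{j+1}(-t-1), which belongs to the next
  row.\<close>

lemma Psi_at:
  assumes S: "S \<in> ssyt n l" and j: "j \<in> {1..n}"
  shows "Psi n l S j (- int t) = int (row_count n l S j t) - int (row_count n l S (Suc j) (Suc t))"
proof -
  have "Psi n l S j (- int t) = (\<Sum>b\<in>shape n l. (if S b = j \<and> fst b = t then 1 else 0)
      - (if S b = Suc j \<and> fst b = Suc t then 1 else 0))"
    unfolding Psi_boxes[OF S] X_mon_def Y_mon_def
    by (intro sum.cong refl arg_cong2[of _ _ _ _ "(-)"] if_cong) (use j in auto)
  also have "\<dots> = int (card {b \<in> shape n l. S b = j \<and> fst b = t})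
      - int (card {b \<in> shape n l. S b = Suc j \<and> fst b = Suc t})"
    unfolding sum_subtractf using finite_shape[of n l] by (simp add: sum.If_cases Int_def conj_ac)
  finally show ?thesis using row_count_shape[OF S] j by simp
qed

lemma Psi_at_pos:
  assumes S: "S \<in> ssyt n l" and "0 < m"
  shows "Psi n l S j m = 0"
  unfolding Psi_boxes[OF S]
proof (rule sum.neutral, rule ballI)
  fix b assume "b \<in> shape n l"
  then have "1 \<le> fst b" using shape_pos by (cases b) auto
  then show "X_mon n (S b) (- int (fst b)) j m = 0"
    using assms(2) by (auto simp: X_mon_def Y_mon_def)
qed

lemma expand_monomial:
  fixes a :: "nat \<Rightarrow> nat \<Rightarrow> int"
  shows "(\<Sum>i = 1..n. \<Sum>m = 0..i. a i m * Y_mon n i (- int m) j k) =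
    (if j \<in> {1..n} \<and> k \<le> 0 \<and> nat (- k) \<le> j then a j (nat (- k)) else 0)"
proof -
  have "(\<Sum>m = 0..i. a i m * Y_mon n i (- int m) j k) =
      (if i = j then (if k \<le> 0 \<and> nat (- k) \<le> j then a j (nat (- k)) else 0) else 0)"
    if "i \<in> {1..n}" for i
  proof -
    have "(\<Sum>m = 0..i. a i m * Y_mon n i (- int m) j k) =
        (\<Sum>m = 0..i. if m = nat (- k) then (if i = j \<and> k \<le> 0 then a j (nat (- k)) else 0) else 0)"
      using that by (intro sum.cong refl) (auto simp: Y_mon_def)
    then show ?thesis by (simp add: sum.delta)
  qed
  then show ?thesis by simp
qed

text \<open>Both kinds of sums telescope. With fixed superscript they give differences of pattern
  entries, nonnegative by interlacing; along a diagonal they leave a single negated row count,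
  because row 0 is empty.\<close>

lemma Psi_in_M_set:
  assumes S: "S \<in> ssyt n l"
  shows "Psi n l S \<in> M_set n l"
proof -
  define a where "a j t = int (row_count n l S j t) - int (row_count n l S (Suc j) (Suc t))" for j t
  have row: "(\<Sum>k = 0..m. a (i + k) i) = int (row_le n l S (i + m) i) - int (row_le n l S (Suc (i + m)) (Suc i))"
    if i: "1 \<le> i" for i m
  proof (induction m)
    case 0
    obtain i' where "i = Suc i'" using i by (cases i) auto
    then show ?case
      using row_le_zero[OF S, of i i'] row_le_zero[OF S, of "Suc i" i]
      by (simp add: a_def row_le_Suc)
  next
    case (Suc m)
    then show ?case by (simp add: a_def row_le_Suc)
  qed
  have diag: "(\<Sum>k = 0..m. a (i + k) k) = - int (row_count n l S (Suc (i + m)) (Suc m))"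
    if i: "1 \<le> i" for i m
  proof (induction m)
    case 0
    then show ?case using row_count_zero[OF S i, of 0] by (simp add: a_def)
  qed (simp add: a_def)
  have row_pos: "0 \<le> (\<Sum>k = 0..m. a (i + k) i)" if "1 \<le> i" for i m
    using row[OF that] row_le_diag[OF S that] by simp
  have diag_neg: "(\<Sum>k = 0..m. a (i + k) k) \<le> 0" if "1 \<le> i" for i m
    using diag[OF that] by simp
  \<comment> \<open>The first sum counts the entries at most n in row i minus the length of row i +
    1; subtracting the second adds the entries n + 1 of row i. What results is the difference of two
    consecutive row lengths.\<close>
  have total: "int (l i) = (\<Sum>k = 0..n - i. a (i + k) i) - (\<Sum>k = 0..i - 1. a (n - i + 1 + k) k)"
    if i: "i \<in> {1..n}" for i
  proof -
    have "(\<Sum>k = 0..n - i. a (i + k) i) = int (row_le n l S n i) - int (row_length n l (Suc i))"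
      using row[of i "n - i"] i row_le_full[OF S, of "Suc i"] by simp
    moreover have "(\<Sum>k = 0..i - 1. a (n - i + 1 + k) k) = - int (row_count n l S (Suc n) i)"
      using diag[of "n - i + 1" "i - 1"] i by simp
    moreover have "row_length n l i = row_le n l S n i + row_count n l S (Suc n) i"
      using row_le_full[OF S, of i] by (simp add: row_le_Suc)
    ultimately show ?thesis using row_length_Suc[of i n l] i by simp
  qed
  have "Psi n l S j k = (\<Sum>i = 1..n. \<Sum>m = 0..i. a i m * Y_mon n i (- int m) j k)" for j k
  proof (cases "j \<in> {1..n} \<and> k \<le> 0")
    case True
    then have "Psi n l S j k = a j (nat (- k))"
      using Psi_at[OF S, of j "nat (- k)"] by (simp add: a_def)
    moreover have "a j (nat (- k)) = 0" if "\<not> nat (- k) \<le> j"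
      using row_count_zero[OF S] True that by (simp add: a_def)
    ultimately show ?thesis unfolding expand_monomial using True by auto
  next
    case False
    then have "Psi n l S j k = 0"
      using Psi_at_pos[OF S, of k j] Psi_monomial[OF S] unfolding monomials_def by auto
    then show ?thesis unfolding expand_monomial using False by auto
  qed
  then have eq: "Psi n l S = (\<lambda>j k. \<Sum>i = 1..n. \<Sum>m = 0..i. a i m * Y_mon n i (- int m) j k)"
    by (intro ext)
  have ends: "a i i \<ge> 0" "a i 0 \<le> 0" if "i \<in> {1..n}" for i
    using row_pos[of i 0] diag_neg[of i 0] that by simp_all
  show ?thesis
    unfolding M_set_def
  proof (intro CollectI conjI exI[of _ a] ballI)
    show "Psi n l S \<in> monomials n" by (rule Psi_monomial[OF S])
    show "Psi n l S = (\<lambda>j k. \<Sum>i = 1..n. \<Sum>m = 0..i. a i m * Y_mon n i (- int m) j k)"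
      by (rule eq)
    fix i assume i: "i \<in> {1..n}"
    show "0 \<le> a i i" "a i 0 \<le> 0" by (rule ends[OF i])+
    show "int (l i) = (\<Sum>k = 0..n - i. a (i + k) i) - (\<Sum>k = 0..i - 1. a (n - i + 1 + k) k)"
      by (rule total[OF i])
  next
    fix j i assume "i \<in> {1..n - j}"
    then have i: "1 \<le> i" by simp
    show "(\<Sum>k = 0..j. a (i + k) k) \<le> 0" by (rule diag_neg[OF i])
    show "0 \<le> (\<Sum>k = 0..j. a (i + k) i)" by (rule row_pos[OF i])
  qed
qed

section \<open>Recovering a tableau from its monomial\<close>

lemma down_closed_card:
  fixes A :: "nat set"
  assumes "finite A" "0 \<notin> A" "\<And>c d. c \<in> A \<Longrightarrow> 1 \<le> d \<Longrightarrow> d \<le> c \<Longrightarrow> d \<in> A"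
  shows "A = {1..card A}"
proof (cases "A = {}")
  case False
  then have "A = {1..Max A}"
    using assms(2) Max_in[OF assms(1) False] Max_ge[OF assms(1)] assms(3)[of "Max A"]
    by (auto simp: Suc_le_eq intro: gr0I)
  then have "card A = Max A" by (metis card_atLeastAtMost diff_Suc_1)
  then show ?thesis using \<open>A = {1..Max A}\<close> by simp
qed simp

lemma entry_le_iff:
  assumes S: "S \<in> ssyt n l" and rc: "(r, c) \<in> shape n l"
  shows "S (r, c) \<le> k \<longleftrightarrow> c \<le> row_le n l S k r"
proof -
  have c: "c \<in> {1..row_length n l r}" using rc by (simp add: shape_def)
  have "{c \<in> {1..row_length n l r}. S (r, c) \<le> k} = {1..row_le n l S k r}"
    unfolding row_le_def
  proof (rule down_closed_card)
    fix c d assume "c \<in> {c \<in> {1..row_length n l r}. S (r, c) \<le> k}" "1 \<le> d" "d \<le> c"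
    moreover from this have "(r, c) \<in> shape n l" using rc by (simp add: shape_def)
    ultimately show "d \<in> {c \<in> {1..row_length n l r}. S (r, c) \<le> k}"
      using ssyt_row[OF S, of r c d] by auto
  qed auto
  then show ?thesis using c by (auto simp: set_eq_iff)
qed

text \<open>The exponent of Y_j(-r) determines the count of j + 1 in row r + 1 from the count of j
  in row r. Starting from the empty row 0, all row counts follow, and weakly increasing rows are
  determined by their counts.\<close>

lemma inj_Psi: "inj_on (Psi n l) (ssyt n l)"
proof (rule inj_onI)
  fix S T assume S: "S \<in> ssyt n l" and T: "T \<in> ssyt n l" and eq: "Psi n l S = Psi n l T"
  have full: "(\<Sum>k = 1..n + 1. row_count n l U k r) = row_length n l r" if "U \<in> ssyt n l" "1 \<le> r" for U r
  proof -
    have "row_le n l U m r = (\<Sum>k = 1..m. row_count n l U k r)" for m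
      using row_le_zero[OF that, of 0] that(2) by (induction m) (simp_all add: row_le_Suc)
    from this[of "n + 1"] show ?thesis using row_le_full[OF that(1), of r] by simp
  qed
  have cnt: "\<forall>k\<in>{1..n + 1}. row_count n l S k r = row_count n l T k r" for r
  proof (induction r)
    case 0
    then show ?case using row_count_zero[OF S] row_count_zero[OF T] by simp
  next
    case (Suc r)
    have ge2: "row_count n l S k (Suc r) = row_count n l T k (Suc r)" if k: "k \<in> {2..n + 1}" for k
    proof -
      obtain j where j: "k = Suc j" "j \<in> {1..n}" using k by (cases k) auto
      then have "row_count n l S j r = row_count n l T j r" using Suc by simp
      then show ?thesis using Psi_at[OF S j(2), of r] Psi_at[OF T j(2), of r] eq j(1) by simp
    qed
    \<comment> \<open>The recursion reaches only entries from 2 on; the count of 1 is supplied by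
      the row length.\<close>
    have "(\<Sum>k = 1..n + 1. row_count n l U k (Suc r)) =
        row_count n l U 1 (Suc r) + (\<Sum>k = 2..n + 1. row_count n l U k (Suc r))" for U
      using sum.atLeast_Suc_atMost[of 1 "n + 1" "\<lambda>k. row_count n l U k (Suc r)"]
      by (simp only: numeral_2_eq_2 One_nat_def)
    moreover have "(\<Sum>k = 2..n + 1. row_count n l S k (Suc r)) = (\<Sum>k = 2..n + 1. row_count n l T k (Suc r))"
      by (rule sum.cong) (use ge2 in auto)
    ultimately have "row_count n l S 1 (Suc r) = row_count n l T 1 (Suc r)"
      using full[OF S, of "Suc r"] full[OF T, of "Suc r"] by simp
    moreover have "{1..n + 1} = insert 1 {2..n + 1}" by auto
    ultimately show ?case using ge2 by simp
  qed
  show "S = T"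
  proof
    fix b
    show "S b = T b"
    proof (cases "b \<in> shape n l")
      case True
      then obtain r c where b: "b = (r, c)" "(r, c) \<in> shape n l" by (cases b) auto
      have r: "1 \<le> r" using shape_pos[OF b(2)] by simp
      have le: "row_le n l S k r = row_le n l T k r" if "k \<le> n + 1" for k
        using that cnt[of r] row_le_zero[OF S r, of 0] row_le_zero[OF T r, of 0] r
        by (induction k) (simp_all add: row_le_Suc)
      have "S (r, c) \<le> n + 1" "T (r, c) \<le> n + 1"
        using ssyt_range[OF S b(2)] ssyt_range[OF T b(2)] by auto
      then have "S (r, c) \<le> T (r, c)" "T (r, c) \<le> S (r, c)"
        using entry_le_iff[OF S b(2)] entry_le_iff[OF T b(2)] le by (metis order.refl)+
      then show ?thesis using b(1) by simp
    next
      case False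
      then show ?thesis using ssyt_outside[OF S] ssyt_outside[OF T] by simp
    qed
  qed
qed

text \<open>Telescoping along diagonals recovers the number \<open>b k r\<close> of entries \<open>k > r\<close> in row \<open>r\<close> from
  the exponents; the number \<open>N r k\<close> of entries at most \<open>k\<close> in row \<open>r\<close> is what remains of the row
  length.\<close>

lemma surj_Psi:
  assumes M: "M \<in> M_set n l"
  shows "M \<in> Psi n l ` ssyt n l"
proof -
  obtain a where Ma: "M = (\<lambda>j k. \<Sum>i = 1..n. \<Sum>m = 0..i. a i m * Y_mon n i (- int m) j k)"
    and ends: "\<And>i. i \<in> {1..n} \<Longrightarrow> 0 \<le> a i i \<and> a i 0 \<le> 0"
    and total: "\<And>i. i \<in> {1..n} \<Longrightarrow>
      int (l i) = (\<Sum>k = 0..n - i. a (i + k) i) - (\<Sum>k = 0..i - 1. a (n - i + 1 + k) k)"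
    and sums: "\<And>j i. j \<in> {1..n - 1} \<Longrightarrow> i \<in> {1..n - j} \<Longrightarrow>
      (\<Sum>k = 0..j. a (i + k) k) \<le> 0 \<and> 0 \<le> (\<Sum>k = 0..j. a (i + k) i)"
    using M unfolding M_set_def mem_Collect_eq by (elim conjE exE) blast
  have Mm: "M \<in> monomials n" using M by (simp add: M_set_def)
  define L where "L = row_length n l"
  \<comment> \<open>The solution of the recursion \<open>b (Suc k) (Suc r) = b k r - a k r\<close>
    read off from the exponents, with value 0 in row 0.\<close>
  define b where "b k r = - (\<Sum>t<r. a (k - r + t) t)" for k r
  define N where "N r k = (if k < r then 0 else int (L r) - (\<Sum>k' = Suc k..n + 1. b k' r))" for r k
  have b_nonneg: "0 \<le> b k r" if "1 \<le> r" "r < k" "k \<le> n + 1" for k r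
  proof (cases "r = 1")
    case True
    then show ?thesis using ends[of "k - 1"] that by (cases k) (auto simp: b_def)
  next
    case False
    have "{..<r} = {0..r - 1}" using that by auto
    moreover have "r - 1 \<in> {1..n - 1}" "k - r \<in> {1..n - (r - 1)}" using that False by auto
    ultimately show ?thesis using sums[of "r - 1" "k - r"] by (simp add: b_def)
  qed
  have b_Suc: "b (Suc k) (Suc r) = b k r - a k r" if "r \<le> k" for k r
    using that by (simp add: b_def)
  have row_sum: "0 \<le> (\<Sum>k' = r..k. a k' r)" if "1 \<le> r" "r \<le> k" "k \<le> n" for r k
  proof -
    have "(\<Sum>k' = r..k. a k' r) = (\<Sum>t = 0..k - r. a (r + t) r)"
      using that by (intro sum.reindex_bij_witness[of _ "\<lambda>t. r + t" "\<lambda>k'. k' - r"]) auto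
    moreover have "k - r \<in> {1..n - 1}" "r \<in> {1..n - (k - r)}" if "k \<noteq> r"
      using \<open>1 \<le> r\<close> \<open>r \<le> k\<close> \<open>k \<le> n\<close> that by auto
    ultimately show ?thesis using sums[of "k - r" r] ends[of r] that by (cases "k = r") auto
  qed
  have l_eq: "int (l r) = (\<Sum>k' = r..n. a k' r) + b (Suc n) r" if r: "1 \<le> r" "r \<le> n" for r
  proof -
    have "(\<Sum>k' = r..n. a k' r) = (\<Sum>t = 0..n - r. a (r + t) r)"
      using that by (intro sum.reindex_bij_witness[of _ "\<lambda>t. r + t" "\<lambda>k'. k' - r"]) auto
    moreover have "{..<r} = {0..r - 1}" using r by auto
    ultimately show ?thesis using total[of r] r by (simp add: b_def Suc_diff_le)
  qed
  \<comment> \<open>The row lengths differ by \<open>l r\<close>, which by \<open>l_eq\<close> is a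
    full row sum plus \<open>b (Suc n) r\<close>. The latter cancels, and the part of the row sum
    beyond k is removed by the recursion for \<open>b\<close>; the sign condition on what is left is
    interlacing.\<close>
  have N_diag: "N r k - N (Suc r) (Suc k) = (\<Sum>k' = r..k. a k' r)"
    if "1 \<le> r" "r \<le> k" "k \<le> n" for r k
  proof -
    have "(\<Sum>k' = Suc (Suc k)..n + 1. b k' (Suc r)) = (\<Sum>k' = Suc k..n. b (Suc k') (Suc r))"
      using sum.shift_bounds_cl_Suc_ivl[of "\<lambda>k'. b k' (Suc r)" "Suc k" n] by simp
    also have "\<dots> = (\<Sum>k' = Suc k..n. b k' r) - (\<Sum>k' = Suc k..n. a k' r)"
      unfolding sum_subtractf[symmetric] using that by (intro sum.cong) (auto simp: b_Suc)
    finally have 1: "(\<Sum>k' = Suc (Suc k)..n + 1. b k' (Suc r)) =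
        (\<Sum>k' = Suc k..n. b k' r) - (\<Sum>k' = Suc k..n. a k' r)" .
    have 2: "(\<Sum>k' = Suc k..n + 1. b k' r) = (\<Sum>k' = Suc k..n. b k' r) + b (Suc n) r"
      using that by simp
    have "{r..n} = {r..k} \<union> {Suc k..n}" using that by auto
    moreover have "sum (\<lambda>k'. a k' r) ({r..k} \<union> {Suc k..n}) = (\<Sum>k' = r..k. a k' r) + (\<Sum>k' = Suc k..n. a k' r)"
      by (rule sum.union_disjoint) auto
    ultimately have 3: "(\<Sum>k' = r..n. a k' r) = (\<Sum>k' = r..k. a k' r) + (\<Sum>k' = Suc k..n. a k' r)"
      by simp
    have 4: "int (L r) = int (l r) + int (L (Suc r))"
      using row_length_Suc[of r n l] that by (simp add: L_def)
    show ?thesis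
      using 1 2 3 4 l_eq[of r] that by (simp add: N_def)
  qed
  have N_diag_le: "N (Suc r) (Suc k) \<le> N r k" if "1 \<le> r" "r \<le> k" "k \<le> n" for r k
    using N_diag[OF that] row_sum[OF that] by simp
  have N_last: "N (Suc n) k = 0" for k
    by (simp add: N_def L_def row_length_out)
  \<comment> \<open>Here \<open>N r r\<close> is merely a remainder, on which no sign condition
    speaks directly. Its nonnegativity is carried up the diagonal from the empty row n + 1.\<close>
  have N_start: "0 \<le> N r r" if "1 \<le> r" "r \<le> Suc n" for r
    using that(2,1)
  proof (induction r rule: inc_induct)
    case base
    then show ?case by (simp add: N_last)
  next
    case (step r)
    then show ?case using N_diag_le[of r r] by simp
  qed
  have N_step: "N r (Suc k) = N r k + b (Suc k) r" if "r \<le> k" "k \<le> n" for r k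
  proof -
    have "(\<Sum>k' = Suc k..n + 1. b k' r) = b (Suc k) r + (\<Sum>k' = Suc (Suc k)..n + 1. b k' r)"
      using that by (intro sum.atLeast_Suc_atMost) simp
    then show ?thesis using that by (simp add: N_def)
  qed
  have N_mono: "N r k \<le> N r k'" if "1 \<le> r" "r \<le> Suc n" "k \<le> k'" for r k k'
    using that(3)
  proof (induction k' rule: dec_induct)
    case (step k')
    have "N r k' \<le> N r (Suc k')"
    proof (cases "k' < r")
      case True
      then show ?thesis using N_start[OF that(1,2)] by (cases "Suc k' = r") (auto simp: N_def)
    next
      case False
      then show ?thesis
        using N_step[of r k'] b_nonneg[of r "Suc k'"] that
        by (cases "k' \<le> n") (auto simp: N_def)
    qed
    then show ?case using step by simp
  qed simp
  have N_full: "N r (n + 1) = int (L r)" if "r \<le> Suc n" for r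
    using that by (simp add: N_def)
  have N_le: "N r k \<le> int (L r)" if "1 \<le> r" "r \<le> Suc n" for r k
    using N_mono[OF that, of k "max k (n + 1)"] N_full[OF that(2)] that
    by (cases "k \<le> n + 1") (auto simp: N_def max_def)
  have N_nonneg: "0 \<le> N r k" if "1 \<le> r" "r \<le> Suc n" for r k
    using N_mono[OF that, of 0 k] that by (simp add: N_def)
  \<comment> \<open>Row r is filled so that exactly its first \<open>N r k\<close> boxes hold
    entries at most k; hence column c receives the least k with c at most
    \<open>N r k\<close>.\<close>
  define S :: tableau where
    "S = (\<lambda>(r, c). if (r, c) \<in> shape n l then LEAST k. int c \<le> N r k else 0)"
  have S_out: "S x = 0" if "x \<notin> shape n l" for x
    using that by (cases x) (simp add: S_def)
  have shD: "1 \<le> r" "r \<le> n" "1 \<le> c" "c \<le> L r" if "(r, c) \<in> shape n l" for r c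
    using that by (auto simp: shape_def L_def)
  have S_le: "S (r, c) \<le> k \<longleftrightarrow> int c \<le> N r k" if rc: "(r, c) \<in> shape n l" for r c k
  proof -
    have S: "S (r, c) = (LEAST k. int c \<le> N r k)" using rc by (simp add: S_def)
    have "int c \<le> N r (n + 1)" using N_full[of r] shD[OF rc] by simp
    then have "int c \<le> N r (S (r, c))" unfolding S by (rule LeastI)
    then show ?thesis
      using N_mono[of r "S (r, c)" k] shD[OF rc] Least_le[of "\<lambda>k. int c \<le> N r k" k] S by auto
  qed
  have S_ge: "r \<le> S (r, c)" if rc: "(r, c) \<in> shape n l" for r c
  proof (rule ccontr)
    assume "\<not> r \<le> S (r, c)"
    then have "N r (S (r, c)) = 0" by (simp add: N_def)
    then show False using S_le[OF rc, of "S (r, c)"] shD[OF rc] by simp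
  qed
  have SS: "S \<in> ssyt n l"
    unfolding ssyt_def
  proof (intro CollectI conjI allI impI ballI)
    fix x assume "x \<notin> shape n l" then show "S x = 0" by (rule S_out)
  next
    fix x assume x: "x \<in> shape n l"
    obtain r c where rc: "x = (r, c)" by (cases x)
    have "S (r, c) \<le> n + 1" using S_le[of r c "n + 1"] N_full[of r] x rc shD[of r c] by simp
    moreover have "1 \<le> S (r, c)" using S_ge[of r c] x rc shD(1)[of r c] by simp
    ultimately show "S x \<in> {1..n + 1}" using rc by simp
  next
    fix r c assume "(r, c) \<in> shape n l \<and> (r, c + 1) \<in> shape n l"
    then have rc: "(r, c) \<in> shape n l" "(r, c + 1) \<in> shape n l" by auto
    show "S (r, c) \<le> S (r, c + 1)"
      unfolding S_le[OF rc(1)] using S_le[OF rc(2), of "S (r, c + 1)"] by simp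
  next
    fix r c assume "(r, c) \<in> shape n l \<and> (r + 1, c) \<in> shape n l"
    then have rc: "(r, c) \<in> shape n l" "(Suc r, c) \<in> shape n l" by auto
    obtain k where k: "S (Suc r, c) = Suc k" "r \<le> k" using S_ge[OF rc(2)] by (cases "S (Suc r, c)") auto
    have "Suc k \<le> n + 1"
      using S_le[OF rc(2), of "n + 1"] N_full[of "Suc r"] shD[OF rc(2)] k by simp
    \<comment> \<open>Interlacing turns into column strictness: if c boxes of the lower row hold at
      most k + 1, then c boxes of the upper row hold at most k.\<close>
    then have "N (Suc r) (Suc k) \<le> N r k" using N_diag_le[of r k] k shD[OF rc(1)] by simp
    then have "S (r, c) \<le> k"
      unfolding S_le[OF rc(1)] using S_le[OF rc(2), of "Suc k"] k by simp
    then show "S (r, c) < S (r + 1, c)" using k by simp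
  qed
  have row_le: "int (row_le n l S k r) = N r k" if r: "1 \<le> r" "r \<le> Suc n" for r k
  proof (cases "r = Suc n")
    case True
    then show ?thesis by (simp add: N_last row_le_def row_length_out)
  next
    case False
    have "{c \<in> {1..row_length n l r}. S (r, c) \<le> k} = {1..nat (N r k)}"
    proof (intro equalityI subsetI)
      fix c assume c: "c \<in> {c \<in> {1..row_length n l r}. S (r, c) \<le> k}"
      then have "(r, c) \<in> shape n l" using r False by (simp add: shape_def)
      then show "c \<in> {1..nat (N r k)}"
        using S_le[of r c k] c N_nonneg[OF r, of k] by (simp add: le_nat_iff)
    next
      fix c assume c: "c \<in> {1..nat (N r k)}"
      then have "int c \<le> N r k" using N_nonneg[OF r, of k] by (simp add: le_nat_iff)
      then have "c \<le> row_length n l r" using N_le[OF r, of k] by (simp add: L_def)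
      moreover from this have "(r, c) \<in> shape n l" using r c False by (simp add: shape_def)
      ultimately show "c \<in> {c \<in> {1..row_length n l r}. S (r, c) \<le> k}"
        using S_le[of r c k] c \<open>int c \<le> N r k\<close> by simp
    qed
    then show ?thesis using N_nonneg[OF r, of k] by (simp add: row_le_def)
  qed
  have cnt: "int (row_count n l S (Suc k) r) = N r (Suc k) - N r k" if "1 \<le> r" "r \<le> Suc n" for r k
    using row_le[OF that, of "Suc k"] row_le[OF that, of k] by (simp add: row_le_Suc)
  have at: "Psi n l S j (- int t) = (if t \<le> j then a j t else 0)" if j: "j \<in> {1..n}" for j t
  proof -
    obtain j' where j': "j = Suc j'" using j by (cases j) auto
    consider "t = 0" | "1 \<le> t" "t \<le> j" | "j < t" by linarith
    then show ?thesis
    proof cases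
      case 1
      have "N 1 (Suc j) = N 1 j + b (Suc j) 1" by (rule N_step) (use j in auto)
      then show ?thesis
        using Psi_at[OF SS j, of t] row_count_zero[OF SS, of j 0] cnt[of 1 j] 1 j
        by (simp add: b_def)
    next
      case 2
      have tn: "t \<le> n" using 2 j by simp
      \<comment> \<open>The two row counts are differences of \<open>N\<close>; regrouped along
        diagonals they become two partial row sums that differ in the single term
        \<open>a j t\<close>.\<close>
      have d: "Psi n l S j (- int t) = (N t j - N (Suc t) (Suc j)) - (N t j' - N (Suc t) (Suc j'))"
        using Psi_at[OF SS j, of t] cnt[of t j'] cnt[of "Suc t" j] 2 tn j' by simp
      show ?thesis
      proof (cases "t = j")
        case True
        then show ?thesis using d N_diag[of t j] 2 j j' by (simp add: N_def)
      next
        case False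
        have "(\<Sum>k' = t..j. a k' t) = (\<Sum>k' = t..j'. a k' t) + a j t"
          using 2 False j' by simp
        then show ?thesis using d N_diag[of t j] N_diag[of t j'] 2 j j' False by simp
      qed
    next
      case 3
      then show ?thesis
        using Psi_at[OF SS j, of t] row_count_zero[OF SS, of j t] row_count_zero[OF SS, of "Suc j" "Suc t"] j
        by simp
    qed
  qed
  have "Psi n l S = M"
  proof (intro ext)
    fix j :: nat and k :: int
    consider "j \<notin> {1..n}" | "j \<in> {1..n}" "0 < k" | "j \<in> {1..n}" "k \<le> 0" by linarith
    then show "Psi n l S j k = M j k"
    proof cases
      case 1
      then show ?thesis using Psi_monomial[OF SS] Mm by (simp add: monomials_def)
    next
      case 2
      then show ?thesis unfolding Ma expand_monomial by (simp add: Psi_at_pos[OF SS])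
    next
      case 3
      then show ?thesis unfolding Ma expand_monomial using at[of j "nat (- k)"] by simp
    qed
  qed
  then show ?thesis using SS by blast
qed

theorem theorem4p8:
  fixes n :: nat and l :: "nat \<Rightarrow> nat"
  assumes "n \<ge> 1"
  shows "crystal_iso n (tableau_crystal n l) (M_crystal n l) (Psi n l) \<and>
         (\<exists>\<Phi>. crystal_iso n (tableau_crystal n l) (M_crystal n l) \<Phi>)"
proof -
  have "crystal_iso n (tableau_crystal n l) (M_crystal n l) (Psi n l)"
    unfolding M_crystal_def
  proof (rule crystal_iso_onto_image[OF is_crystal_monomial_crystal],
      unfold tableau_crystal_def monomial_crystal_def crystal.simps)
    show "inj_on (Psi n l) (ssyt n l)" by (rule inj_Psi)
    show "Psi n l ` ssyt n l = M_set n l" using Psi_in_M_set surj_Psi by blast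
    show "M_set n l \<subseteq> monomials n" by (auto simp: M_set_def)
  next
    fix i S assume i: "i \<in> {1..n}" and S: "S \<in> ssyt n l"
    show "S' \<in> ssyt n l" if "tab_e n l i S = Some S'" for S' using tab_e_SomeD(1)[OF S i that] .
    show "S' \<in> ssyt n l" if "tab_f n l i S = Some S'" for S' using tab_f_SomeD[OF S i that] by blast
    show "Some (mon_eps i (Psi n l S)) = Some (int (length (remaining_ones n l i S)))"
      by (simp add: mon_eps_Psi[OF S i])
    show "Some (mon_phi i (Psi n l S)) = Some (int (length (remaining_zeros n l i S)))"
      by (simp add: mon_phi_Psi[OF S i])
    show "mon_e n i (Psi n l S) = map_option (Psi n l) (tab_e n l i S)" by (rule mon_e_Psi[OF S i])
    show "mon_f n i (Psi n l S) = map_option (Psi n l) (tab_f n l i S)" by (rule mon_f_Psi[OF S i])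
  next
    fix S assume "S \<in> ssyt n l"
    then show "mon_wt n (Psi n l S) = tab_wt n l S" by (rule mon_wt_Psi)
  qed
  then show ?thesis by blast
qed

end
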